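(* The category of Lie groups $\mathtt{LieGrp}$ and the category of pointed Lie heaps $\mathtt{LieHp}_*$ are isomorphic as categories; that is, there exist functors $F:\mathtt{LieGrp}\to\mathtt{LieHp}_*$ and $G:\mathtt{LieHp}_*\to\mathtt{LieGrp}$ such that $F\circ G=\mathrm{Id}_{\mathtt{LieHp}_*}$ and $G\circ F=\mathrm{Id}_{\mathtt{LieGrp}}$.
   Context: All manifolds are real, finite dimensional, Hausdorff, second countable smooth manifolds. A semiheap is a set $S$ with a ternary operation $\mu:S^3\to S$, $\mu(x,y,z)=[x,y,z]$, satisfying the para-associative law $[[x_1,x_2,x_3],x_4,x_5]=[x_1,[x_4,x_3,x_2],x_5]=[x_1,x_2,[x_3,x_4,x_5]]$ for all $x_i\in S$. A heap is a semiheap in which every element is biunitary: $[y,x,x]=y=[x,x,y]$ for all $x,y\in S$. A Lie semiheap is a smooth manifold $S$ with a semiheap operation $\mu$ that is a smooth map; a Lie heap is a Lie semiheap that is a heap. A pointed Lie heap is a triple $(H,\mu,e)$ with $(H,\mu)$ a Lie heap and $e\in H$ a distinguished point. Morphisms $\phi:(H,\mu,e)\to(H',\mu',e')$ in $\mathtt{LieHp}_*$ are smooth maps with $\phi([x,y,z])=[\phi(x),\phi(y),\phi(z)]'$ for all $x,y,z$ and $\phi(e)=e'$. Morphisms in $\mathtt{LieGrp}$ are smooth group homomorphisms. *)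

theory Defs
  imports "HOL-Analysis.Analysis" "HOL-Algebra.Group"
begin

section \<open>Smooth maps between open subsets of Euclidean spaces\<close>

text \<open>
  The dimension has to vary from object to object, so \<open>n\<close>-dimensional space is the library's
  \<^const>\<open>Euclidean_space\<close> \<open>n\<close>, whose points are the sequences \<open>nat \<Rightarrow> real\<close> vanishing from
  index \<open>n\<close> on.
\<close>

definition has_partial ::
  "((nat \<Rightarrow> real) \<Rightarrow> real) \<Rightarrow> nat \<Rightarrow> (nat \<Rightarrow> real) set \<Rightarrow> ((nat \<Rightarrow> real) \<Rightarrow> real) \<Rightarrow> bool" where
  "has_partial f i W g \<longleftrightarrow>
     (\<forall>x\<in>W. ((\<lambda>t. f (x(i := t))) has_real_derivative g x) (at (x i)))"

text \<open>
  \<open>Ck_on n k W f\<close>: all partial derivatives of \<open>f\<close> up to order \<open>k\<close> exist and are continuous on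
  \<open>W\<close>. It is only meant for \<open>W\<close> open in \<open>Euclidean_space n\<close>.
\<close>

fun Ck_on :: "nat \<Rightarrow> nat \<Rightarrow> (nat \<Rightarrow> real) set \<Rightarrow> ((nat \<Rightarrow> real) \<Rightarrow> real) \<Rightarrow> bool" where
  "Ck_on n 0 W f \<longleftrightarrow> continuous_map (subtopology (Euclidean_space n) W) euclideanreal f"
| "Ck_on n (Suc k) W f \<longleftrightarrow>
     continuous_map (subtopology (Euclidean_space n) W) euclideanreal f \<and>
     (\<forall>i<n. \<exists>g. has_partial f i W g \<and> Ck_on n k W g)"

definition smooth_euclidean ::
  "nat \<Rightarrow> nat \<Rightarrow> (nat \<Rightarrow> real) set \<Rightarrow> ((nat \<Rightarrow> real) \<Rightarrow> nat \<Rightarrow> real) \<Rightarrow> bool" where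
  "smooth_euclidean n m W f \<longleftrightarrow> (\<forall>j<m. \<forall>k. Ck_on n k W (\<lambda>x. f x j))"


section \<open>Smooth manifolds\<close>

text \<open>
  A chart is a pair of its domain and its coordinate map. Throughout, functions defined on a
  subset of a type are taken in \<^const>\<open>extensional\<close> form (value \<^const>\<open>undefined\<close> outside of
  the subset), so that HOL equality is equality of functions on that subset.
\<close>

type_synonym 'a chart = "'a set \<times> ('a \<Rightarrow> nat \<Rightarrow> real)"

definition is_chart :: "'a topology \<Rightarrow> nat \<Rightarrow> 'a chart \<Rightarrow> bool" where
  "is_chart X n = (\<lambda>(U, \<phi>).
     openin X U \<and> \<phi> \<in> extensional U \<and> openin (Euclidean_space n) (\<phi> ` U) \<and>
     homeomorphic_map (subtopology X U) (subtopology (Euclidean_space n) (\<phi> ` U)) \<phi>)"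

definition smooth_transition :: "nat \<Rightarrow> 'a chart \<Rightarrow> 'a chart \<Rightarrow> bool" where
  "smooth_transition n = (\<lambda>(U, \<phi>) (V, \<psi>).
     smooth_euclidean n n (\<phi> ` (U \<inter> V)) (\<psi> \<circ> inv_into U \<phi>))"

definition compatible :: "nat \<Rightarrow> 'a chart \<Rightarrow> 'a chart \<Rightarrow> bool" where
  "compatible n c d \<longleftrightarrow> smooth_transition n c d \<and> smooth_transition n d c"

definition compatible_charts ::
  "'a topology \<Rightarrow> nat \<Rightarrow> 'a chart set \<Rightarrow> 'a chart set" where
  "compatible_charts X n A = {c. is_chart X n c \<and> (\<forall>d\<in>A. compatible n c d)}"

record 'a manifold =
  mtop :: "'a topology"
  mdim :: nat
  atlas :: "'a chart set"

abbreviation points :: "'a manifold \<Rightarrow> 'a set" where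
  "points M \<equiv> topspace (mtop M)"

text \<open>
  The last conjunct says at once that the elements of the atlas are pairwise compatible charts
  and that the atlas is maximal, i.e. is a smooth structure.
\<close>

definition smooth_manifold :: "'a manifold \<Rightarrow> bool" where
  "smooth_manifold M \<longleftrightarrow>
     Hausdorff_space (mtop M) \<and> second_countable (mtop M) \<and>
     (\<Union>(U, \<phi>)\<in>atlas M. U) = points M \<and>
     atlas M = compatible_charts (mtop M) (mdim M) (atlas M)"

definition smooth_map :: "'a manifold \<Rightarrow> 'b manifold \<Rightarrow> ('a \<Rightarrow> 'b) \<Rightarrow> bool" where
  "smooth_map M N f \<longleftrightarrow>
     f \<in> points M \<rightarrow> points N \<and>
     (\<forall>p\<in>points M. \<exists>U \<phi> V \<psi>.
        (U, \<phi>) \<in> atlas M \<and> (V, \<psi>) \<in> atlas N \<and> p \<in> U \<and> f ` U \<subseteq> V \<and>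
        smooth_euclidean (mdim M) (mdim N) (\<phi> ` U) (\<psi> \<circ> f \<circ> inv_into U \<phi>))"

definition join_coords :: "nat \<Rightarrow> (nat \<Rightarrow> real) \<Rightarrow> (nat \<Rightarrow> real) \<Rightarrow> nat \<Rightarrow> real" where
  "join_coords m x y = (\<lambda>i. if i < m then x i else y (i - m))"

definition product_chart :: "nat \<Rightarrow> 'a chart \<Rightarrow> 'b chart \<Rightarrow> ('a \<times> 'b) chart" where
  "product_chart m = (\<lambda>(U, \<phi>) (V, \<psi>).
     (U \<times> V, \<lambda>(x, y)\<in>U \<times> V. join_coords m (\<phi> x) (\<psi> y)))"

text \<open>The smooth structure of a product is the maximal atlas generated by the product charts.\<close>

definition product_manifold ::
  "'a manifold \<Rightarrow> 'b manifold \<Rightarrow> ('a \<times> 'b) manifold" where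
  "product_manifold M N =
     \<lparr> mtop = prod_topology (mtop M) (mtop N),
       mdim = mdim M + mdim N,
       atlas = compatible_charts (prod_topology (mtop M) (mtop N)) (mdim M + mdim N)
                 {product_chart (mdim M) c d | c d. c \<in> atlas M \<and> d \<in> atlas N} \<rparr>"


section \<open>Lie groups\<close>

definition lie_group :: "'a manifold \<Rightarrow> 'a monoid \<Rightarrow> bool" where
  "lie_group M G \<longleftrightarrow>
     smooth_manifold M \<and> group G \<and> carrier G = points M \<and>
     case_prod (mult G) \<in> extensional (carrier G \<times> carrier G) \<and>
     smooth_map (product_manifold M M) M (\<lambda>(x, y). x \<otimes>\<^bsub>G\<^esub> y) \<and>
     smooth_map M M (\<lambda>x. inv\<^bsub>G\<^esub> x)"


section \<open>Lie semiheaps and Lie heaps\<close>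

definition semiheap :: "'a set \<Rightarrow> ('a \<times> 'a \<times> 'a \<Rightarrow> 'a) \<Rightarrow> bool" where
  "semiheap S \<mu> \<longleftrightarrow>
     \<mu> \<in> S \<times> S \<times> S \<rightarrow>\<^sub>E S \<and>
     (\<forall>x1\<in>S. \<forall>x2\<in>S. \<forall>x3\<in>S. \<forall>x4\<in>S. \<forall>x5\<in>S.
        \<mu> (\<mu> (x1, x2, x3), x4, x5) = \<mu> (x1, \<mu> (x4, x3, x2), x5) \<and>
        \<mu> (x1, \<mu> (x4, x3, x2), x5) = \<mu> (x1, x2, \<mu> (x3, x4, x5)))"

definition heap :: "'a set \<Rightarrow> ('a \<times> 'a \<times> 'a \<Rightarrow> 'a) \<Rightarrow> bool" where
  "heap S \<mu> \<longleftrightarrow>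
     semiheap S \<mu> \<and> (\<forall>x\<in>S. \<forall>y\<in>S. \<mu> (y, x, x) = y \<and> \<mu> (x, x, y) = y)"

definition lie_semiheap :: "'a manifold \<Rightarrow> ('a \<times> 'a \<times> 'a \<Rightarrow> 'a) \<Rightarrow> bool" where
  "lie_semiheap M \<mu> \<longleftrightarrow>
     smooth_manifold M \<and> semiheap (points M) \<mu> \<and>
     smooth_map (product_manifold M (product_manifold M M)) M \<mu>"

definition lie_heap :: "'a manifold \<Rightarrow> ('a \<times> 'a \<times> 'a \<Rightarrow> 'a) \<Rightarrow> bool" where
  "lie_heap M \<mu> \<longleftrightarrow> lie_semiheap M \<mu> \<and> heap (points M) \<mu>"

definition pointed_lie_heap :: "'a manifold \<Rightarrow> ('a \<times> 'a \<times> 'a \<Rightarrow> 'a) \<Rightarrow> 'a \<Rightarrow> bool" where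
  "pointed_lie_heap M \<mu> e \<longleftrightarrow> lie_heap M \<mu> \<and> e \<in> points M"


section \<open>Categories and functors\<close>

text \<open>
  Categories are given by families of hom-sets; \<open>Comp C X Y Z g f\<close> is the composite of
  \<open>f \<in> Hom C X Y\<close> and \<open>g \<in> Hom C Y Z\<close>.
\<close>

record ('o, 'm) precategory =
  Obj :: "'o set"
  Hom :: "'o \<Rightarrow> 'o \<Rightarrow> 'm set"
  Ident :: "'o \<Rightarrow> 'm"
  Comp :: "'o \<Rightarrow> 'o \<Rightarrow> 'o \<Rightarrow> 'm \<Rightarrow> 'm \<Rightarrow> 'm"

definition category :: "('o, 'm) precategory \<Rightarrow> bool" where
  "category C \<longleftrightarrow>
     (\<forall>X\<in>Obj C. Ident C X \<in> Hom C X X) \<and>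
     (\<forall>X\<in>Obj C. \<forall>Y\<in>Obj C. \<forall>Z\<in>Obj C. \<forall>f\<in>Hom C X Y. \<forall>g\<in>Hom C Y Z.
        Comp C X Y Z g f \<in> Hom C X Z) \<and>
     (\<forall>X\<in>Obj C. \<forall>Y\<in>Obj C. \<forall>f\<in>Hom C X Y.
        Comp C X X Y f (Ident C X) = f \<and> Comp C X Y Y (Ident C Y) f = f) \<and>
     (\<forall>W\<in>Obj C. \<forall>X\<in>Obj C. \<forall>Y\<in>Obj C. \<forall>Z\<in>Obj C.
        \<forall>f\<in>Hom C W X. \<forall>g\<in>Hom C X Y. \<forall>h\<in>Hom C Y Z.
        Comp C W X Z (Comp C X Y Z h g) f = Comp C W Y Z h (Comp C W X Y g f))"

record ('o1, 'm1, 'o2, 'm2) functor_data =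
  obj_map :: "'o1 \<Rightarrow> 'o2"
  hom_map :: "'o1 \<Rightarrow> 'o1 \<Rightarrow> 'm1 \<Rightarrow> 'm2"

definition is_functor ::
  "('o1, 'm1) precategory \<Rightarrow> ('o2, 'm2) precategory \<Rightarrow> ('o1, 'm1, 'o2, 'm2) functor_data \<Rightarrow> bool"
  where
  "is_functor C D F \<longleftrightarrow>
     category C \<and> category D \<and>
     (\<forall>X\<in>Obj C. obj_map F X \<in> Obj D) \<and>
     (\<forall>X\<in>Obj C. \<forall>Y\<in>Obj C. \<forall>f\<in>Hom C X Y.
        hom_map F X Y f \<in> Hom D (obj_map F X) (obj_map F Y)) \<and>
     (\<forall>X\<in>Obj C. hom_map F X X (Ident C X) = Ident D (obj_map F X)) \<and>
     (\<forall>X\<in>Obj C. \<forall>Y\<in>Obj C. \<forall>Z\<in>Obj C. \<forall>f\<in>Hom C X Y. \<forall>g\<in>Hom C Y Z.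
        hom_map F X Z (Comp C X Y Z g f) =
        Comp D (obj_map F X) (obj_map F Y) (obj_map F Z) (hom_map F Y Z g) (hom_map F X Y f))"

definition id_functor :: "('o, 'm, 'o, 'm) functor_data" where
  "id_functor = \<lparr> obj_map = (\<lambda>X. X), hom_map = (\<lambda>X Y f. f) \<rparr>"

definition comp_functor ::
  "('o2, 'm2, 'o3, 'm3) functor_data \<Rightarrow> ('o1, 'm1, 'o2, 'm2) functor_data \<Rightarrow>
   ('o1, 'm1, 'o3, 'm3) functor_data" where
  "comp_functor F G =
     \<lparr> obj_map = (\<lambda>X. obj_map F (obj_map G X)),
       hom_map = (\<lambda>X Y f. hom_map F (obj_map G X) (obj_map G Y) (hom_map G X Y f)) \<rparr>"

text \<open>Equality of functors with source \<open>C\<close>: they agree on the objects and the morphisms of \<open>C\<close>.\<close>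

definition functor_eq ::
  "('o1, 'm1) precategory \<Rightarrow> ('o1, 'm1, 'o2, 'm2) functor_data \<Rightarrow>
   ('o1, 'm1, 'o2, 'm2) functor_data \<Rightarrow> bool" where
  "functor_eq C F G \<longleftrightarrow>
     (\<forall>X\<in>Obj C. obj_map F X = obj_map G X) \<and>
     (\<forall>X\<in>Obj C. \<forall>Y\<in>Obj C. \<forall>f\<in>Hom C X Y. hom_map F X Y f = hom_map G X Y f)"


section \<open>The categories of Lie groups and of pointed Lie heaps\<close>

text \<open>
  The type variable plays the role of the universe: objects are all Lie groups, respectively
  pointed Lie heaps, whose set of points is a subset of that type.
\<close>

type_synonym 'a lie_group_obj = "'a manifold \<times> 'a monoid"

type_synonym 'a pointed_lie_heap_obj = "'a manifold \<times> ('a \<times> 'a \<times> 'a \<Rightarrow> 'a) \<times> 'a"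

definition LieGrp :: "('a lie_group_obj, 'a \<Rightarrow> 'a) precategory" where
  "LieGrp =
     \<lparr> Obj = {(M, G). lie_group M G},
       Hom = (\<lambda>(M, G) (N, H).
         {\<phi> \<in> extensional (points M). \<phi> \<in> hom G H \<and> smooth_map M N \<phi>}),
       Ident = (\<lambda>(M, G). \<lambda>x\<in>points M. x),
       Comp = (\<lambda>(M, G) _ _ \<psi> \<phi>. compose (points M) \<psi> \<phi>) \<rparr>"

definition LieHp_pt :: "('a pointed_lie_heap_obj, 'a \<Rightarrow> 'a) precategory" where
  "LieHp_pt =
     \<lparr> Obj = {(M, \<mu>, e). pointed_lie_heap M \<mu> e},
       Hom = (\<lambda>(M, \<mu>, e) (N, \<nu>, e').
         {\<phi> \<in> extensional (points M). smooth_map M N \<phi> \<and>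
           (\<forall>x\<in>points M. \<forall>y\<in>points M. \<forall>z\<in>points M. \<phi> (\<mu> (x, y, z)) = \<nu> (\<phi> x, \<phi> y, \<phi> z)) \<and>
           \<phi> e = e'}),
       Ident = (\<lambda>(M, \<mu>, e). \<lambda>x\<in>points M. x),
       Comp = (\<lambda>(M, \<mu>, e) _ _ \<psi> \<phi>. compose (points M) \<psi> \<phi>) \<rparr>"

end

theory Submission
  imports Defs
begin

text \<open>
  A Lie group becomes a heap by \<open>[x, y, z] = x y\<inverse> z\<close>, and a pointed heap becomes a group with
  unit \<open>e\<close>, product \<open>[x, e, y]\<close> and inverse \<open>[e, x, e]\<close>. These constructions are mutually inverse
  and leave the underlying manifolds and maps unchanged, so that the functors are the identity on
  morphisms. Each new operation is built from the old ones by composition, pairing, projections and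
  constant maps. Hence its smoothness reduces to the closure of smooth maps under these, and
  ultimately to the chain rule for \<open>C\<^sup>k\<close> functions in terms of partial derivatives.
\<close>

section \<open>Calculus on open subsets of Euclidean spaces\<close>

lemma Euclidean_space_eq_top_of_set: "Euclidean_space n = top_of_set {x. \<forall>i\<ge>n. x i = 0}"
  by (simp add: Euclidean_space_def euclidean_product_topology)

lemma subtopology_Euclidean_space_eq:
  assumes "openin (Euclidean_space n) W"
  shows "subtopology (Euclidean_space n) W = top_of_set W"
  using openin_subset[OF assms]
  by (simp add: Euclidean_space_eq_top_of_set subtopology_subtopology inf_absorb2)

lemma openin_Euclidean_spaceE:
  assumes "openin (Euclidean_space n) W"
  obtains T where "open T" "W = {x. \<forall>i\<ge>n. x i = 0} \<inter> T"
  using assms by (auto simp: Euclidean_space_eq_top_of_set openin_open)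

lemma openin_Euclidean_space_zero:
  assumes "openin (Euclidean_space n) W" "x \<in> W" "n \<le> i"
  shows "x i = 0"
  using assms openin_subset[OF assms(1)] by (auto simp: topspace_Euclidean_space)

lemma open_fun_contains_box:
  fixes T :: "(nat \<Rightarrow> real) set"
  assumes "open T" "x \<in> T"
  obtains d where "d > 0" "\<And>y. (\<And>i. \<bar>y i - x i\<bar> < d) \<Longrightarrow> y \<in> T"
proof -
  have "openin (product_topology (\<lambda>i. euclidean) UNIV) T"
    using assms(1) by (simp add: euclidean_product_topology)
  from product_topology_open_contains_basis[OF this assms(2)]
  obtain X where X: "x \<in> (\<Pi>\<^sub>E i\<in>UNIV. X i)" "\<And>i. open (X i)"
      "finite {i. X i \<noteq> UNIV}" "(\<Pi>\<^sub>E i\<in>UNIV. X i) \<subseteq> T"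
    by auto
  have "\<exists>e>0. ball (x i) e \<subseteq> X i" for i
    using X(1) X(2)[of i] by (auto simp: PiE_iff intro: openE)
  then obtain e where e: "\<And>i. e i > 0" "\<And>i. ball (x i) (e i) \<subseteq> X i"
    by metis
  define d where "d = Min (insert 1 (e ` {i. X i \<noteq> UNIV}))"
  have "d > 0"
    using X(3) e(1) by (auto simp: d_def)
  moreover have "y \<in> T" if y: "\<And>i. \<bar>y i - x i\<bar> < d" for y
  proof -
    have "y i \<in> X i" for i
    proof (cases "X i = UNIV")
      case False
      then have "d \<le> e i"
        using X(3) by (auto simp: d_def)
      then show ?thesis
        using y[of i] e(2)[of i] by (auto simp: dist_real_def abs_minus_commute subset_iff)
    qed auto
    then show ?thesis
      using X(4) by auto
  qed
  ultimately show ?thesis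
    using that by blast
qed

lemma openin_Euclidean_space_box:
  assumes "openin (Euclidean_space n) W" "x \<in> W"
  obtains d where "d > 0"
    "\<And>y. (\<And>i. i < n \<Longrightarrow> \<bar>y i - x i\<bar> < d) \<Longrightarrow> (\<And>i. n \<le> i \<Longrightarrow> y i = 0) \<Longrightarrow> y \<in> W"
proof -
  obtain T where T: "open T" "W = {x. \<forall>i\<ge>n. x i = 0} \<inter> T"
    using openin_Euclidean_spaceE[OF assms(1)] .
  obtain d where d: "d > 0" "\<And>y. (\<And>i. \<bar>y i - x i\<bar> < d) \<Longrightarrow> y \<in> T"
    using open_fun_contains_box[of T x] T assms(2) by blast
  have "y \<in> W" if "\<And>i. i < n \<Longrightarrow> \<bar>y i - x i\<bar> < d" "\<And>i. n \<le> i \<Longrightarrow> y i = 0" for y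
  proof -
    have "\<bar>y i - x i\<bar> < d" for i
      using that d(1) assms T(2) by (cases "i < n") auto
    then show ?thesis
      using d(2) T(2) that(2) by auto
  qed
  then show ?thesis
    using that d(1) by blast
qed

lemma tendsto_fun_coordinatewise:
  fixes y :: "'b \<Rightarrow> nat \<Rightarrow> real"
  assumes "\<And>i. ((\<lambda>t. y t i) \<longlongrightarrow> x i) F"
  shows "(y \<longlongrightarrow> x) F"
proof -
  have "limitin (product_topology (\<lambda>i. euclidean) UNIV) y x F"
    using assms by (auto simp: limitin_componentwise)
  then show ?thesis
    by (simp add: euclidean_product_topology)
qed

lemma eventually_update_in:
  assumes "openin (Euclidean_space n) W" "x \<in> W" "i < n"
  shows "eventually (\<lambda>t. x(i := t) \<in> W) (nhds (x i))"
proof -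
  obtain d where "d > 0"
    "\<And>y. (\<And>i. i < n \<Longrightarrow> \<bar>y i - x i\<bar> < d) \<Longrightarrow> (\<And>i. n \<le> i \<Longrightarrow> y i = 0) \<Longrightarrow> y \<in> W"
    using openin_Euclidean_space_box[OF assms(1,2)] by metis
  then show ?thesis
    using openin_Euclidean_space_zero[OF assms(1,2)] assms(3)
    by (auto simp: eventually_nhds_metric dist_real_def intro!: exI[of _ d])
qed

lemma Ck_on_continuous:
  assumes "openin (Euclidean_space n) W" "Ck_on n k W f"
  shows "continuous_on W f"
  using assms by (cases k) (auto simp: subtopology_Euclidean_space_eq)

lemma Ck_on_Suc_iff:
  assumes "openin (Euclidean_space n) W"
  shows "Ck_on n (Suc k) W f \<longleftrightarrow>
    continuous_on W f \<and> (\<exists>g. \<forall>i<n. has_partial f i W (g i) \<and> Ck_on n k W (g i))"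
  using assms by (auto simp: subtopology_Euclidean_space_eq) metis+

lemma Ck_on_0_iff:
  assumes "openin (Euclidean_space n) W"
  shows "Ck_on n 0 W f \<longleftrightarrow> continuous_on W f"
  using assms by (auto simp: subtopology_Euclidean_space_eq)

declare Ck_on.simps [simp del]

lemma Ck_on_cong:
  assumes "openin (Euclidean_space n) W" "\<And>x. x \<in> W \<Longrightarrow> f x = f' x" "Ck_on n k W f"
  shows "Ck_on n k W f'"
proof -
  have partial: "has_partial f' i W g" if "i < n" "has_partial f i W g" for i g
    unfolding has_partial_def
  proof
    fix x assume x: "x \<in> W"
    have "eventually (\<lambda>t. f (x(i := t)) = f' (x(i := t))) (nhds (x i))"
      using eventually_update_in[OF assms(1) x that(1)] assms(2) by (auto elim: eventually_mono)
    moreover have "((\<lambda>t. f (x(i := t))) has_real_derivative g x) (at (x i))"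
      using that(2) x by (auto simp: has_partial_def)
    ultimately show "((\<lambda>t. f' (x(i := t))) has_real_derivative g x) (at (x i))"
      by (subst DERIV_cong_ev[OF refl _ refl, symmetric])
  qed
  have cont: "continuous_on W f'"
    using Ck_on_continuous[OF assms(1,3)] assms(2) by (metis continuous_on_cong)
  show ?thesis
  proof (cases k)
    case 0
    then show ?thesis
      by (simp add: cont Ck_on_0_iff[OF assms(1)])
  next
    case (Suc k')
    then obtain g where "\<And>i. i < n \<Longrightarrow> has_partial f i W (g i) \<and> Ck_on n k' W (g i)"
      using assms(3) unfolding Suc Ck_on_Suc_iff[OF assms(1)] by metis
    then have "\<forall>i<n. has_partial f' i W (g i) \<and> Ck_on n k' W (g i)"
      using partial by simp
    then show ?thesis
      unfolding Suc Ck_on_Suc_iff[OF assms(1)] using cont by metis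
  qed
qed

lemma Ck_on_antimono_Suc:
  assumes "openin (Euclidean_space n) W" "Ck_on n (Suc k) W f"
  shows "Ck_on n k W f"
  using assms(2)
proof (induction k arbitrary: f)
  case 0
  then show ?case
    by (simp only: Ck_on_0_iff[OF assms(1)] Ck_on_Suc_iff[OF assms(1)])
next
  case (Suc k)
  obtain g where g: "continuous_on W f" "\<And>i. i < n \<Longrightarrow> has_partial f i W (g i) \<and> Ck_on n (Suc k) W (g i)"
    using Suc.prems unfolding Ck_on_Suc_iff[OF assms(1), of "Suc k"] by metis
  then have "\<forall>i<n. has_partial f i W (g i) \<and> Ck_on n k W (g i)"
    using Suc.IH by simp
  with g(1) show ?case
    unfolding Ck_on_Suc_iff[OF assms(1), of k] by metis
qed

lemma Ck_on_subset:
  assumes "openin (Euclidean_space n) W" "openin (Euclidean_space n) W'" "W' \<subseteq> W" "Ck_on n k W f"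
  shows "Ck_on n k W' f"
  using assms(4)
proof (induction k arbitrary: f)
  case 0
  then show ?case
    using assms(3) by (auto simp: Ck_on_0_iff[OF assms(1)] Ck_on_0_iff[OF assms(2)] intro: continuous_on_subset)
next
  case (Suc k)
  obtain g where "continuous_on W f" "\<And>i. i < n \<Longrightarrow> has_partial f i W (g i) \<and> Ck_on n k W (g i)"
    using Suc.prems unfolding Ck_on_Suc_iff[OF assms(1)] by metis
  then have "continuous_on W' f" "\<And>i. i < n \<Longrightarrow> has_partial f i W' (g i) \<and> Ck_on n k W' (g i)"
    using Suc.IH assms(3) by (auto simp: has_partial_def intro: continuous_on_subset)
  then show ?case
    unfolding Ck_on_Suc_iff[OF assms(2)] by metis
qed

lemma Ck_on_local:
  assumes W: "openin (Euclidean_space n) W"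
    and "\<And>x. x \<in> W \<Longrightarrow> \<exists>W'. openin (Euclidean_space n) W' \<and> x \<in> W' \<and> W' \<subseteq> W \<and> Ck_on n k W' f"
  shows "Ck_on n k W f"
  using assms(2)
proof (induction k arbitrary: f)
  case 0
  have "\<exists>T. open T \<and> x \<in> T \<and> continuous_on (W \<inter> T) f" if x: "x \<in> W" for x
  proof -
    obtain W' where W': "openin (Euclidean_space n) W'" "x \<in> W'" "W' \<subseteq> W" "Ck_on n 0 W' f"
      using 0 x by blast
    then obtain T where "open T" "W' = {x. \<forall>i\<ge>n. x i = 0} \<inter> T"
      using openin_Euclidean_spaceE by blast
    moreover have "W \<inter> T \<subseteq> W'"
      using calculation openin_subset[OF W] by (auto simp: topspace_Euclidean_space)
    ultimately show ?thesis
      using W'(2) continuous_on_subset[OF Ck_on_continuous[OF W'(1,4)]] by blast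
  qed
  then have "continuous (at x within W) f" if "x \<in> W" for x
  proof -
    obtain T where T: "open T" "x \<in> T" "continuous_on (W \<inter> T) f"
      using \<open>\<And>x. x \<in> W \<Longrightarrow> \<exists>T. open T \<and> x \<in> T \<and> continuous_on (W \<inter> T) f\<close> \<open>x \<in> W\<close> by blast
    moreover have "at x within W = at x within W \<inter> T"
      using T by (intro at_within_nhd[of x T]) auto
    ultimately show ?thesis
      using \<open>x \<in> W\<close> by (simp add: continuous_on_eq_continuous_within)
  qed
  then show ?case
    by (simp add: Ck_on_0_iff[OF W] continuous_on_eq_continuous_within)
next
  case (Suc k)
  define g where "g i x = (SOME D. ((\<lambda>t. f (x(i := t))) has_real_derivative D) (at (x i)))" for i x
  have loc: "\<exists>W'. openin (Euclidean_space n) W' \<and> x \<in> W' \<and> W' \<subseteq> W \<and> continuous_on W' f \<and>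
     (\<forall>i<n. has_partial f i W' (g i) \<and> Ck_on n k W' (g i))" if x: "x \<in> W" for x
  proof -
    obtain W' where W': "openin (Euclidean_space n) W'" "x \<in> W'" "W' \<subseteq> W" "Ck_on n (Suc k) W' f"
      using Suc.prems[OF x] by metis
    then obtain h where h: "continuous_on W' f" "\<And>i. i < n \<Longrightarrow> has_partial f i W' (h i) \<and> Ck_on n k W' (h i)"
      unfolding Ck_on_Suc_iff[OF W'(1)] by metis
    have eq: "h i y = g i y" if "i < n" "y \<in> W'" for i y
    proof -
      have *: "((\<lambda>t. f (y(i := t))) has_real_derivative h i y) (at (y i))"
        using h(2) that by (auto simp: has_partial_def)
      then have "((\<lambda>t. f (y(i := t))) has_real_derivative g i y) (at (y i))"
        unfolding g_def by (rule someI)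
      with * show ?thesis
        by (rule DERIV_unique)
    qed
    have "has_partial f i W' (g i) \<and> Ck_on n k W' (g i)" if "i < n" for i
      using h(2)[OF that] eq[OF that] Ck_on_cong[OF W'(1), of "h i" "g i" k]
      by (simp add: has_partial_def)
    with W' h(1) show ?thesis
      by metis
  qed
  have "has_partial f i W (g i)" if "i < n" for i
    using loc that unfolding has_partial_def by metis
  moreover have "Ck_on n k W (g i)" if "i < n" for i
    by (rule Suc.IH) (use loc that in metis)
  moreover have "continuous_on W f"
  proof -
    have "\<exists>W'. openin (Euclidean_space n) W' \<and> x \<in> W' \<and> W' \<subseteq> W \<and> Ck_on n k W' f" if "x \<in> W" for x
      using Suc.prems[OF that] Ck_on_antimono_Suc by metis
    from Ck_on_continuous[OF W Suc.IH[OF this]] show ?thesis .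
  qed
  ultimately show ?case
    unfolding Ck_on_Suc_iff[OF W] by metis
qed

lemma Ck_on_const: "openin (Euclidean_space n) W \<Longrightarrow> Ck_on n k W (\<lambda>x. c)"
proof (induction k arbitrary: c)
  case (Suc k)
  then show ?case
    unfolding Ck_on_Suc_iff[OF Suc.prems]
    by (auto simp: has_partial_def intro!: exI[of _ "\<lambda>i x. 0"])
qed (simp add: Ck_on_0_iff)

lemma Ck_on_coordinate:
  assumes "openin (Euclidean_space n) W"
  shows "Ck_on n k W (\<lambda>x. x j)"
proof (cases k)
  case 0
  then show ?thesis
    using assms by (auto simp: Ck_on_0_iff intro: continuous_on_product_then_coordinatewise continuous_on_id)
next
  case (Suc k')
  have "has_partial (\<lambda>x. x j) i W (\<lambda>x. if i = j then 1 else 0)" for i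
    by (auto simp: has_partial_def)
  moreover have "Ck_on n k' W (\<lambda>x. if i = j then 1 else 0)" for i
    using Ck_on_const[OF assms] by simp
  ultimately show ?thesis
    unfolding Suc Ck_on_Suc_iff[OF assms] by (auto intro!: continuous_on_product_then_coordinatewise continuous_on_id exI[of _ "\<lambda>i x. if i = j then 1 else 0"])
qed

lemma Ck_on_add:
  assumes W: "openin (Euclidean_space n) W" and "Ck_on n k W f" "Ck_on n k W f'"
  shows "Ck_on n k W (\<lambda>x. f x + f' x)"
  using assms(2,3)
proof (induction k arbitrary: f f')
  case 0
  then show ?case
    by (auto simp: Ck_on_0_iff[OF W] continuous_on_add)
next
  case (Suc k)
  obtain g where g: "continuous_on W f" "\<And>i. i < n \<Longrightarrow> has_partial f i W (g i) \<and> Ck_on n k W (g i)"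
    using Suc.prems unfolding Ck_on_Suc_iff[OF W] by metis
  obtain g' where g': "continuous_on W f'" "\<And>i. i < n \<Longrightarrow> has_partial f' i W (g' i) \<and> Ck_on n k W (g' i)"
    using Suc.prems unfolding Ck_on_Suc_iff[OF W] by metis
  show ?case
    unfolding Ck_on_Suc_iff[OF W]
  proof (intro conjI exI allI impI)
    show "continuous_on W (\<lambda>x. f x + f' x)"
      using g(1) g'(1) by (rule continuous_on_add)
    fix i assume i: "i < n"
    show "Ck_on n k W (\<lambda>x. g i x + g' i x)"
      using Suc.IH g g' i by blast
    show "has_partial (\<lambda>x. f x + f' x) i W (\<lambda>x. g i x + g' i x)"
      using g(2)[OF i] g'(2)[OF i] by (auto simp: has_partial_def intro!: DERIV_add)
  qed
qed

lemma Ck_on_mult: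
  assumes W: "openin (Euclidean_space n) W" and "Ck_on n k W f" "Ck_on n k W f'"
  shows "Ck_on n k W (\<lambda>x. f x * f' x)"
  using assms(2,3)
proof (induction k arbitrary: f f')
  case 0
  then show ?case
    by (auto simp: Ck_on_0_iff[OF W] continuous_on_mult)
next
  case (Suc k)
  obtain g where g: "continuous_on W f" "\<And>i. i < n \<Longrightarrow> has_partial f i W (g i) \<and> Ck_on n k W (g i)"
    using Suc.prems unfolding Ck_on_Suc_iff[OF W] by metis
  obtain g' where g': "continuous_on W f'" "\<And>i. i < n \<Longrightarrow> has_partial f' i W (g' i) \<and> Ck_on n k W (g' i)"
    using Suc.prems unfolding Ck_on_Suc_iff[OF W] by metis
  have low: "Ck_on n k W f" "Ck_on n k W f'"
    using Suc.prems Ck_on_antimono_Suc[OF W] by auto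
  show ?case
    unfolding Ck_on_Suc_iff[OF W]
  proof (intro conjI exI allI impI)
    show "continuous_on W (\<lambda>x. f x * f' x)"
      using g(1) g'(1) by (rule continuous_on_mult)
    fix i assume i: "i < n"
    show "Ck_on n k W (\<lambda>x. g i x * f' x + g' i x * f x)"
      using Suc.IH g g' i low by (intro Ck_on_add[OF W]) auto
    show "has_partial (\<lambda>x. f x * f' x) i W (\<lambda>x. g i x * f' x + g' i x * f x)"
      using g(2)[OF i] g'(2)[OF i] DERIV_mult
      by (fastforce simp: has_partial_def)
  qed
qed

lemma Ck_on_sum:
  assumes "openin (Euclidean_space n) W" "\<And>j. j \<in> J \<Longrightarrow> Ck_on n k W (f j)"
  shows "Ck_on n k W (\<lambda>x. \<Sum>j\<in>J. f j x)"
  using assms(2)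
proof (induction J rule: infinite_finite_induct)
  case (insert j J)
  then show ?case
    using Ck_on_add[OF assms(1)] by simp
qed (use Ck_on_const[OF assms(1)] in simp_all)

text \<open>
  The coordinates of the curve are switched on one at a time; each step is controlled by the mean
  value theorem along a single coordinate, so that continuity of the partial derivatives suffices.
\<close>

lemma has_real_derivative_along_curve:
  assumes V: "openin (Euclidean_space m) V"
    and part: "\<And>j. j < m \<Longrightarrow> has_partial f j V (g j)"
    and cont: "\<And>j. j < m \<Longrightarrow> continuous_on V (g j)"
    and c0: "c t0 \<in> V" and zero: "\<And>t j. m \<le> j \<Longrightarrow> c t j = 0"
    and c': "\<And>j. j < m \<Longrightarrow> ((\<lambda>t. c t j) has_real_derivative c' j) (at t0)"
  shows "((\<lambda>t. f (c t)) has_real_derivative (\<Sum>j<m. g j (c t0) * c' j)) (at t0)"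
proof -
  obtain d where d: "d > 0" "\<And>y. (\<And>i. i < m \<Longrightarrow> \<bar>y i - c t0 i\<bar> < d) \<Longrightarrow> (\<And>i. m \<le> i \<Longrightarrow> y i = 0) \<Longrightarrow> y \<in> V"
    using openin_Euclidean_space_box[OF V c0] by metis
  have clim: "((\<lambda>t. c t j) \<longlongrightarrow> c t0 j) (at t0)" for j
    using DERIV_isCont[OF c'] zero by (cases "j < m") (auto simp: isCont_def)
  have near: "eventually (\<lambda>t. \<forall>j\<in>{..<m}. \<bar>c t j - c t0 j\<bar> < d) (at t0)"
    using tendstoD[OF clim d(1)] by (intro eventually_ball_finite) (auto simp: dist_real_def)
  define p where "p s t = (\<lambda>j. if j < s then c t j else c t0 j)" for s t
  have "((\<lambda>t. f (p s t)) has_real_derivative (\<Sum>j<s. g j (c t0) * c' j)) (at t0)" if "s \<le> m" for s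
    using that
  proof (induction s)
    case 0
    then show ?case
      by (simp add: p_def)
  next
    case (Suc s)
    then have s: "s < m" by simp
    have "\<exists>r. \<bar>r - c t0 s\<bar> \<le> \<bar>c t s - c t0 s\<bar> \<and>
            f (p (Suc s) t) - f (p s t) = (c t s - c t0 s) * g s ((p s t)(s := r)) \<and>
            (p s t)(s := r) \<in> V"
      if t: "\<forall>j\<in>{..<m}. \<bar>c t j - c t0 j\<bar> < d" for t
    proof -
      have in_V: "(p s t)(s := r) \<in> V" if "\<bar>r - c t0 s\<bar> \<le> \<bar>c t s - c t0 s\<bar>" for r
        using t that zero d(1) s by (intro d(2)) (fastforce simp: p_def)+
      have der: "((\<lambda>r. f ((p s t)(s := r))) has_real_derivative g s ((p s t)(s := r))) (at r)"
        if "\<bar>r - c t0 s\<bar> \<le> \<bar>c t s - c t0 s\<bar>" for r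
        using bspec[OF part[OF s, unfolded has_partial_def] in_V[OF that]] by simp
      have ends: "(p s t)(s := c t s) = p (Suc s) t" "(p s t)(s := c t0 s) = p s t"
        by (auto simp: p_def fun_eq_iff less_Suc_eq)
      consider "c t0 s < c t s" | "c t s < c t0 s" | "c t0 s = c t s" by linarith
      then show ?thesis
      proof cases
        case 1
        then obtain r where "c t0 s < r" "r < c t s"
          "f ((p s t)(s := c t s)) - f ((p s t)(s := c t0 s)) = (c t s - c t0 s) * g s ((p s t)(s := r))"
          using MVT2[OF 1, of "\<lambda>r. f ((p s t)(s := r))" "\<lambda>r. g s ((p s t)(s := r))"] der by auto
        then show ?thesis
          using in_V by (intro exI[of _ r]) (auto simp: ends)
      next
        case 2
        then obtain r where "c t s < r" "r < c t0 s"
          "f ((p s t)(s := c t0 s)) - f ((p s t)(s := c t s)) = (c t0 s - c t s) * g s ((p s t)(s := r))"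
          using MVT2[OF 2, of "\<lambda>r. f ((p s t)(s := r))" "\<lambda>r. g s ((p s t)(s := r))"] der by auto
        then show ?thesis
          using in_V by (intro exI[of _ r]) (auto simp: ends algebra_simps)
      next
        case 3
        then show ?thesis
          using in_V[of "c t0 s"] ends by (intro exI[of _ "c t0 s"]) auto
      qed
    qed
    then obtain r where r: "\<And>t. \<forall>j\<in>{..<m}. \<bar>c t j - c t0 j\<bar> < d \<Longrightarrow>
            \<bar>r t - c t0 s\<bar> \<le> \<bar>c t s - c t0 s\<bar> \<and>
            f (p (Suc s) t) - f (p s t) = (c t s - c t0 s) * g s ((p s t)(s := r t)) \<and>
            (p s t)(s := r t) \<in> V"
      by metis
    have rlim: "(r \<longlongrightarrow> c t0 s) (at t0)"
    proof (rule LIM_zero_cancel)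
      have "((\<lambda>t. c t s - c t0 s) \<longlongrightarrow> 0) (at t0)"
        using clim[of s] by (simp add: LIM_zero)
      then show "((\<lambda>t. r t - c t0 s) \<longlongrightarrow> 0) (at t0)"
        by (rule Lim_null_comparison[OF _ tendsto_rabs_zero, rotated])
          (use near r in \<open>auto elim!: eventually_mono\<close>)
    qed
    have "((\<lambda>t. (p s t)(s := r t)) \<longlongrightarrow> c t0) (at t0)"
    proof (rule tendsto_fun_coordinatewise)
      fix j
      consider "j = s" | "j < s" | "j > s" by linarith
      then show "((\<lambda>t. ((p s t)(s := r t)) j) \<longlongrightarrow> c t0 j) (at t0)"
        using rlim clim by cases (auto simp: p_def)
    qed
    then have glim: "((\<lambda>t. g s ((p s t)(s := r t))) \<longlongrightarrow> g s (c t0)) (at t0)"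
      using near r c0 by (intro continuous_on_tendsto_compose[OF cont[OF s]]) (auto elim!: eventually_mono)
    have "((\<lambda>t. (c t s - c t0 s) / (t - t0) * g s ((p s t)(s := r t))) \<longlongrightarrow> c' s * g s (c t0)) (at t0)"
      using c'[OF s] by (intro tendsto_mult glim) (simp add: has_field_derivative_iff)
    then have "((\<lambda>t. ((f (p (Suc s) t) - f (p s t)) - (f (p (Suc s) t0) - f (p s t0))) / (t - t0))
        \<longlongrightarrow> g s (c t0) * c' s) (at t0)"
      unfolding mult.commute[of "c' s"]
    proof (rule Lim_transform_eventually)
      have "p k t0 = c t0" for k
        by (auto simp: p_def)
      then show "eventually (\<lambda>t. (c t s - c t0 s) / (t - t0) * g s ((p s t)(s := r t)) =
        ((f (p (Suc s) t) - f (p s t)) - (f (p (Suc s) t0) - f (p s t0))) / (t - t0)) (at t0)"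
        using near r by (auto elim!: eventually_mono)
    qed
    then have "((\<lambda>t. f (p (Suc s) t) - f (p s t)) has_real_derivative g s (c t0) * c' s) (at t0)"
      by (simp add: has_field_derivative_iff)
    from DERIV_add[OF this Suc.IH] s show ?case
      by (simp add: add.commute)
  qed
  moreover have "p m = c"
    using zero by (auto simp: p_def fun_eq_iff)
  ultimately show ?thesis
    by (metis order_refl)
qed

lemma Ck_on_compose:
  assumes W: "openin (Euclidean_space n) W" and V: "openin (Euclidean_space m) V"
    and "Ck_on m k V f" and "\<And>j. j < m \<Longrightarrow> Ck_on n k W (\<lambda>x. h x j)"
    and maps: "h \<in> W \<rightarrow> V"
  shows "Ck_on n k W (\<lambda>x. f (h x))"
  using assms(3,4)
proof (induction k arbitrary: f)
  case (0 f)
  have "continuous_on W (\<lambda>x. h x j)" for j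
  proof (cases "j < m")
    case False
    then have "h x j = 0" if "x \<in> W" for x
      using openin_Euclidean_space_zero[OF V, of "h x" j] maps that by auto
    then show ?thesis
      by (metis continuous_on_cong continuous_on_const)
  qed (use 0 Ck_on_continuous[OF W] in blast)
  then have "continuous_on W h"
    by (rule continuous_on_coordinatewise_then_product)
  then have "continuous_on W (\<lambda>x. f (h x))"
    using continuous_on_compose2[OF Ck_on_continuous[OF V 0(1)]] maps by blast
  then show ?case
    by (simp only: Ck_on_0_iff[OF W])
next
  case (Suc k f)
  obtain g where g: "continuous_on V f" "\<And>j. j < m \<Longrightarrow> has_partial f j V (g j) \<and> Ck_on m k V (g j)"
    using Suc.prems(1) unfolding Ck_on_Suc_iff[OF V] by metis
  have "\<exists>h'. \<forall>i<n. has_partial (\<lambda>x. h x j) i W (h' i) \<and> Ck_on n k W (h' i)" if "j < m" for j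
    using Suc.prems(2)[OF that] unfolding Ck_on_Suc_iff[OF W] by metis
  then obtain h' where h': "\<And>i j. i < n \<Longrightarrow> j < m \<Longrightarrow> has_partial (\<lambda>x. h x j) i W (h' j i) \<and> Ck_on n k W (h' j i)"
    by metis
  have low: "Ck_on m k V f" "\<And>j. j < m \<Longrightarrow> Ck_on n k W (\<lambda>x. h x j)"
    using Suc.prems Ck_on_antimono_Suc W V by auto
  show ?case
    unfolding Ck_on_Suc_iff[OF W]
  proof (intro conjI exI allI impI)
    show "continuous_on W (\<lambda>x. f (h x))"
      using Suc.IH[OF low] Ck_on_continuous[OF W] by blast
    fix i assume i: "i < n"
    show "Ck_on n k W (\<lambda>x. \<Sum>j<m. g j (h x) * h' j i x)"
      using Suc.IH g h' low i by (intro Ck_on_sum Ck_on_mult W) auto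
    show "has_partial (\<lambda>x. f (h x)) i W (\<lambda>x. \<Sum>j<m. g j (h x) * h' j i x)"
      unfolding has_partial_def
    proof
      fix x assume x: "x \<in> W"
      define c where "c t = (\<lambda>j. if j < m then h (x(i := t)) j else 0)" for t
      have ev: "eventually (\<lambda>t. x(i := t) \<in> W) (nhds (x i))"
        using eventually_update_in[OF W x i] .
      have ch: "c t = h (x(i := t))" if "x(i := t) \<in> W" for t
        using openin_Euclidean_space_zero[OF V funcset_mem[OF maps that]]
        by (simp add: c_def fun_eq_iff)
      have "((\<lambda>t. f (c t)) has_real_derivative (\<Sum>j<m. g j (c (x i)) * h' j i x)) (at (x i))"
      proof (rule has_real_derivative_along_curve[OF V])
        show "c (x i) \<in> V"
          using ch[of "x i"] x maps by auto
        show "((\<lambda>t. c t j) has_real_derivative h' j i x) (at (x i))" if "j < m" for j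
          using h'[OF i that] x that by (auto simp: has_partial_def c_def)
      qed (use g Ck_on_continuous[OF V] in \<open>auto simp: c_def\<close>)
      moreover have "eventually (\<lambda>t. f (c t) = f (h (x(i := t)))) (nhds (x i))"
        using ev ch by (auto elim: eventually_mono)
      ultimately have "((\<lambda>t. f (h (x(i := t)))) has_real_derivative (\<Sum>j<m. g j (c (x i)) * h' j i x)) (at (x i))"
        by (subst DERIV_cong_ev[OF refl _ refl, symmetric])
      then show "((\<lambda>t. f (h (x(i := t)))) has_real_derivative (\<Sum>j<m. g j (h x) * h' j i x)) (at (x i))"
        using ch[of "x i"] x by simp
    qed
  qed
qed

lemma smooth_euclidean_cong:
  assumes "openin (Euclidean_space n) W" "\<And>x j. x \<in> W \<Longrightarrow> j < m \<Longrightarrow> f x j = f' x j"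
    and "smooth_euclidean n m W f"
  shows "smooth_euclidean n m W f'"
  using assms(3) Ck_on_cong[OF assms(1), of "\<lambda>x. f x j" "\<lambda>x. f' x j" for j] assms(2)
  unfolding smooth_euclidean_def by blast

lemma smooth_euclidean_subset:
  assumes "openin (Euclidean_space n) W" "openin (Euclidean_space n) W'" "W' \<subseteq> W"
    and "smooth_euclidean n m W f"
  shows "smooth_euclidean n m W' f"
  using assms(4) Ck_on_subset[OF assms(1-3)] unfolding smooth_euclidean_def by blast

lemma smooth_euclidean_local:
  assumes "openin (Euclidean_space n) W"
    and "\<And>x. x \<in> W \<Longrightarrow> \<exists>W'. openin (Euclidean_space n) W' \<and> x \<in> W' \<and> W' \<subseteq> W \<and> smooth_euclidean n m W' f"
  shows "smooth_euclidean n m W f"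
  unfolding smooth_euclidean_def
proof (intro allI impI)
  fix j k assume "j < m"
  show "Ck_on n k W (\<lambda>x. f x j)"
  proof (rule Ck_on_local[OF assms(1)])
    fix x assume "x \<in> W"
    show "\<exists>W'. openin (Euclidean_space n) W' \<and> x \<in> W' \<and> W' \<subseteq> W \<and> Ck_on n k W' (\<lambda>x. f x j)"
      using assms(2)[OF \<open>x \<in> W\<close>] \<open>j < m\<close> unfolding smooth_euclidean_def by metis
  qed
qed

lemma smooth_euclidean_compose:
  assumes "openin (Euclidean_space n) W" "openin (Euclidean_space m) V"
    and "smooth_euclidean n m W h" "smooth_euclidean m l V f" "h \<in> W \<rightarrow> V"
  shows "smooth_euclidean n l W (\<lambda>x. f (h x))"
  unfolding smooth_euclidean_def
proof (intro allI impI)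
  fix j k assume "j < l"
  show "Ck_on n k W (\<lambda>x. f (h x) j)"
    using assms(3,4) \<open>j < l\<close> Ck_on_compose[OF assms(1,2) _ _ assms(5), of k "\<lambda>y. f y j"]
    unfolding smooth_euclidean_def by blast
qed

lemma smooth_euclidean_id:
  "openin (Euclidean_space n) W \<Longrightarrow> smooth_euclidean n n W (\<lambda>x. x)"
  by (simp add: smooth_euclidean_def Ck_on_coordinate)

lemma smooth_euclidean_const:
  "openin (Euclidean_space n) W \<Longrightarrow> smooth_euclidean n m W (\<lambda>x. c)"
  by (simp add: smooth_euclidean_def Ck_on_const)

lemma continuous_map_Euclidean_space:
  assumes "f \<in> topspace X \<rightarrow> topspace (Euclidean_space n)"
    and "\<And>i. i < n \<Longrightarrow> continuous_map X euclideanreal (\<lambda>x. f x i)"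
  shows "continuous_map X (Euclidean_space n) f"
proof -
  have "continuous_map X euclideanreal (\<lambda>x. f x i)" for i
  proof (cases "i < n")
    case False
    then have "f x i = 0" if "x \<in> topspace X" for x
      using funcset_mem[OF assms(1) that] by (auto simp: topspace_Euclidean_space)
    then show ?thesis
      using continuous_map_eq[of X euclideanreal "\<lambda>x. 0" "\<lambda>x. f x i"] by auto
  qed (use assms(2) in auto)
  then show ?thesis
    using assms(1)
    by (auto simp: Euclidean_space_def continuous_map_in_subtopology continuous_map_componentwise_UNIV)
qed

lemma smooth_euclidean_continuous_map:
  assumes W: "openin (Euclidean_space n) W" and "smooth_euclidean n m W f"
    and "f \<in> W \<rightarrow> topspace (Euclidean_space m)"
  shows "continuous_map (subtopology (Euclidean_space n) W) (Euclidean_space m) f"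
proof (rule continuous_map_Euclidean_space)
  show "continuous_map (subtopology (Euclidean_space n) W) euclideanreal (\<lambda>x. f x i)" if "i < m" for i
    using assms(2) that Ck_on_continuous[OF W, of 0] W
    by (auto simp: smooth_euclidean_def subtopology_Euclidean_space_eq)
qed (use assms openin_subset[OF W] in auto)

definition left_coords :: "nat \<Rightarrow> (nat \<Rightarrow> real) \<Rightarrow> nat \<Rightarrow> real" where
  "left_coords m z = (\<lambda>i. if i < m then z i else 0)"

definition right_coords :: "nat \<Rightarrow> (nat \<Rightarrow> real) \<Rightarrow> nat \<Rightarrow> real" where
  "right_coords m z = (\<lambda>i. z (i + m))"

lemma left_coords_join [simp]:
  "x \<in> topspace (Euclidean_space m) \<Longrightarrow> left_coords m (join_coords m x y) = x"
  by (auto simp: left_coords_def join_coords_def topspace_Euclidean_space fun_eq_iff)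

lemma right_coords_join [simp]: "right_coords m (join_coords m x y) = y"
  by (auto simp: right_coords_def join_coords_def fun_eq_iff)

lemma join_left_right_coords [simp]: "join_coords m (left_coords m z) (right_coords m z) = z"
  by (auto simp: left_coords_def right_coords_def join_coords_def fun_eq_iff)

lemma join_coords_in_Euclidean_space:
  assumes "y \<in> topspace (Euclidean_space n)"
  shows "join_coords m x y \<in> topspace (Euclidean_space (m + n))"
  using assms by (auto simp: join_coords_def topspace_Euclidean_space)

lemma coords_in_Euclidean_space:
  assumes "z \<in> topspace (Euclidean_space (m + n))"
  shows "left_coords m z \<in> topspace (Euclidean_space m)"
    and "right_coords m z \<in> topspace (Euclidean_space n)"
  using assms by (auto simp: left_coords_def right_coords_def topspace_Euclidean_space)

lemma smooth_left_coords:
  "openin (Euclidean_space k) W \<Longrightarrow> smooth_euclidean k m W (left_coords m)"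
  by (simp add: smooth_euclidean_def left_coords_def Ck_on_coordinate)

lemma smooth_right_coords:
  "openin (Euclidean_space k) W \<Longrightarrow> smooth_euclidean k n W (right_coords m)"
  by (simp add: smooth_euclidean_def right_coords_def Ck_on_coordinate)

lemma smooth_join_coords:
  assumes "smooth_euclidean k m W f" "smooth_euclidean k n W g"
  shows "smooth_euclidean k (m + n) W (\<lambda>x. join_coords m (f x) (g x))"
  unfolding smooth_euclidean_def
proof (intro allI impI)
  fix j l assume "j < m + n"
  then show "Ck_on k l W (\<lambda>x. join_coords m (f x) (g x) j)"
    using assms by (cases "j < m") (auto simp: smooth_euclidean_def join_coords_def)
qed

lemma continuous_map_left_coords:
  "continuous_map (Euclidean_space (m + n)) (Euclidean_space m) (left_coords m)"
  using smooth_euclidean_continuous_map[where f = "left_coords m", OF openin_topspace smooth_left_coords[OF openin_topspace]]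
    coords_in_Euclidean_space by fastforce

lemma continuous_map_right_coords:
  "continuous_map (Euclidean_space (m + n)) (Euclidean_space n) (right_coords m)"
  using smooth_euclidean_continuous_map[where f = "right_coords m", OF openin_topspace smooth_right_coords[OF openin_topspace]]
    coords_in_Euclidean_space by fastforce

section \<open>Charts and atlases\<close>

lemma is_chartD:
  assumes "is_chart X n (U, \<phi>)"
  shows "openin X U" "U \<subseteq> topspace X" "inj_on \<phi> U" "openin (Euclidean_space n) (\<phi> ` U)"
    "homeomorphic_map (subtopology X U) (subtopology (Euclidean_space n) (\<phi> ` U)) \<phi>"
    "continuous_map (subtopology X U) (Euclidean_space n) \<phi>"
    "\<phi> ` U \<subseteq> topspace (Euclidean_space n)"
proof -
  have *: "openin X U" "openin (Euclidean_space n) (\<phi> ` U)"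
    and hom: "homeomorphic_map (subtopology X U) (subtopology (Euclidean_space n) (\<phi> ` U)) \<phi>"
    using assms by (auto simp: is_chart_def)
  then show "openin X U" "U \<subseteq> topspace X" "openin (Euclidean_space n) (\<phi> ` U)"
    "\<phi> ` U \<subseteq> topspace (Euclidean_space n)"
    "homeomorphic_map (subtopology X U) (subtopology (Euclidean_space n) (\<phi> ` U)) \<phi>"
    by (auto dest: openin_subset)
  then show "inj_on \<phi> U"
    using homeomorphic_imp_injective_map[OF hom] by (simp add: Int_absorb1)
  show "continuous_map (subtopology X U) (Euclidean_space n) \<phi>"
    using homeomorphic_imp_continuous_map[OF hom] by (simp add: continuous_map_in_subtopology)
qed

lemma chart_image_open:
  assumes "is_chart X n (U, \<phi>)" "openin X U'" "U' \<subseteq> U"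
  shows "openin (Euclidean_space n) (\<phi> ` U')"
proof -
  note c = is_chartD[OF assms(1)]
  have "openin (subtopology X U) U'"
    using assms(2,3) c(1) by (simp add: openin_open_subtopology)
  then have "openin (subtopology (Euclidean_space n) (\<phi> ` U)) (\<phi> ` U')"
    using homeomorphic_imp_open_map[OF c(5)] by (simp add: open_map_def)
  then show ?thesis
    using c(4) by (simp add: openin_open_subtopology)
qed

lemma chart_inv_continuous_map:
  assumes "is_chart X n (U, \<phi>)"
  shows "continuous_map (subtopology (Euclidean_space n) (\<phi> ` U)) X (inv_into U \<phi>)"
proof -
  note c = is_chartD[OF assms]
  obtain g where g: "homeomorphic_maps (subtopology X U) (subtopology (Euclidean_space n) (\<phi> ` U)) \<phi> g"
    using c(5) homeomorphic_map_maps by blast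
  have "continuous_map (subtopology (Euclidean_space n) (\<phi> ` U)) X g"
    using g by (auto simp: homeomorphic_maps_def continuous_map_in_subtopology)
  then show ?thesis
  proof (rule continuous_map_eq)
    fix y assume "y \<in> topspace (subtopology (Euclidean_space n) (\<phi> ` U))"
    then obtain x where "x \<in> U" "y = \<phi> x" by auto
    then show "g y = inv_into U \<phi> y"
      using g c by (auto simp: homeomorphic_maps_def)
  qed
qed

lemma chart_restrict:
  assumes "is_chart X n (U, \<phi>)" "openin X U'" "U' \<subseteq> U"
  shows "is_chart X n (U', restrict \<phi> U')"
proof -
  note c = is_chartD[OF assms(1)]
  obtain g where g: "homeomorphic_maps (subtopology X U) (subtopology (Euclidean_space n) (\<phi> ` U)) \<phi> g"
    using c(5) homeomorphic_map_maps by blast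
  have "homeomorphic_maps (subtopology (subtopology X U) U')
      (subtopology (subtopology (Euclidean_space n) (\<phi> ` U)) (\<phi> ` U')) \<phi> g"
    using assms(3) c by (intro homeomorphic_maps_subtopologies[OF g]) auto
  moreover have "U \<inter> U' = U'" "\<phi> ` U \<inter> \<phi> ` U' = \<phi> ` U'"
    using assms(3) by auto
  ultimately have "homeomorphic_map (subtopology X U') (subtopology (Euclidean_space n) (\<phi> ` U')) \<phi>"
    by (metis homeomorphic_maps_map subtopology_subtopology)
  then have "homeomorphic_map (subtopology X U') (subtopology (Euclidean_space n) (\<phi> ` U')) (restrict \<phi> U')"
    by (rule homeomorphic_map_eq) auto
  then show ?thesis
    using assms chart_image_open[OF assms] by (auto simp: is_chart_def)
qed

lemma smooth_transition_restrict_left: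
  assumes "is_chart X n (U, \<phi>)" "openin X U'" "U' \<subseteq> U" "openin X V"
    and "smooth_transition n (U, \<phi>) (V, \<psi>)"
  shows "smooth_transition n (U', restrict \<phi> U') (V, \<psi>)"
proof -
  note c = is_chartD[OF assms(1)]
  have o: "openin (Euclidean_space n) (\<phi> ` (U' \<inter> V))" "openin (Euclidean_space n) (\<phi> ` (U \<inter> V))"
    using assms c by (auto intro!: chart_image_open[OF assms(1)])
  have "smooth_euclidean n n (\<phi> ` (U' \<inter> V)) (\<psi> \<circ> inv_into U \<phi>)"
    using assms(3,5) by (intro smooth_euclidean_subset[OF o(2,1)]) (auto simp: smooth_transition_def)
  then have "smooth_euclidean n n (\<phi> ` (U' \<inter> V)) (\<psi> \<circ> inv_into U' (restrict \<phi> U'))"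
  proof (rule smooth_euclidean_cong[OF o(1), rotated])
    fix x j assume "x \<in> \<phi> ` (U' \<inter> V)"
    then obtain u where u: "u \<in> U'" "u \<in> V" "x = \<phi> u" by auto
    moreover have "inj_on (restrict \<phi> U') U'"
      using c(3) assms(3) by (auto simp: inj_on_def)
    then have "inv_into U' (restrict \<phi> U') x = u"
      using u by (metis inv_into_f_f restrict_apply')
    ultimately show "(\<psi> \<circ> inv_into U \<phi>) x j = (\<psi> \<circ> inv_into U' (restrict \<phi> U')) x j"
      using c(3) assms(3) by auto
  qed
  moreover have "restrict \<phi> U' ` (U' \<inter> V) = \<phi> ` (U' \<inter> V)"
    by auto
  ultimately show ?thesis
    by (simp add: smooth_transition_def)
qed

lemma smooth_transition_restrict_right:
  assumes "is_chart X n (V, \<psi>)" "openin X U'" "U' \<subseteq> U" "openin X U"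
    and "smooth_transition n (V, \<psi>) (U, \<phi>)"
  shows "smooth_transition n (V, \<psi>) (U', restrict \<phi> U')"
proof -
  note c = is_chartD[OF assms(1)]
  have o: "openin (Euclidean_space n) (\<psi> ` (V \<inter> U'))" "openin (Euclidean_space n) (\<psi> ` (V \<inter> U))"
    using assms c by (auto intro!: chart_image_open[OF assms(1)])
  have "smooth_euclidean n n (\<psi> ` (V \<inter> U')) (\<phi> \<circ> inv_into V \<psi>)"
    using assms(3,5) by (intro smooth_euclidean_subset[OF o(2,1)]) (auto simp: smooth_transition_def)
  then have "smooth_euclidean n n (\<psi> ` (V \<inter> U')) (restrict \<phi> U' \<circ> inv_into V \<psi>)"
    by (rule smooth_euclidean_cong[OF o(1), rotated]) (use c(3) in auto)
  then show ?thesis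
    by (simp add: smooth_transition_def)
qed

lemma compatible_charts_restrict:
  assumes "(U, \<phi>) \<in> compatible_charts X n A" "\<And>d. d \<in> A \<Longrightarrow> is_chart X n d"
    and "openin X U'" "U' \<subseteq> U"
  shows "(U', restrict \<phi> U') \<in> compatible_charts X n A"
proof -
  have c: "is_chart X n (U, \<phi>)" "\<And>d. d \<in> A \<Longrightarrow> compatible n (U, \<phi>) d"
    using assms(1) by (auto simp: compatible_charts_def)
  have "compatible n (U', restrict \<phi> U') (V, \<psi>)" if "(V, \<psi>) \<in> A" for V \<psi>
    using c(2)[OF that] is_chartD(1)[OF assms(2)[OF that]] is_chartD(1)[OF c(1)] assms(3,4)
    by (auto simp: compatible_def intro: smooth_transition_restrict_left[OF c(1)]
        smooth_transition_restrict_right[OF assms(2)[OF that]])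
  then show ?thesis
    using chart_restrict[OF c(1) assms(3,4)] by (auto simp: compatible_charts_def)
qed

text \<open>Locally, the transition factors through a chart of the given atlas.\<close>

lemma smooth_transition_via_atlas:
  assumes A: "\<And>d. d \<in> A \<Longrightarrow> is_chart X n d" and cover: "topspace X \<subseteq> (\<Union>(U, \<phi>)\<in>A. U)"
    and c: "(U, \<phi>) \<in> compatible_charts X n A" and d: "(V, \<psi>) \<in> compatible_charts X n A"
  shows "smooth_transition n (U, \<phi>) (V, \<psi>)"
proof -
  have cc: "is_chart X n (U, \<phi>)" and dc: "is_chart X n (V, \<psi>)"
    using c d by (auto simp: compatible_charts_def)
  note cD = is_chartD[OF cc] and dD = is_chartD[OF dc]
  have UV: "openin (Euclidean_space n) (\<phi> ` (U \<inter> V))"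
    using cD(1) dD(1) by (auto intro: chart_image_open[OF cc])
  show ?thesis
    unfolding smooth_transition_def prod.case
  proof (rule smooth_euclidean_local[OF UV])
    fix x assume "x \<in> \<phi> ` (U \<inter> V)"
    then obtain u where u: "u \<in> U" "u \<in> V" "x = \<phi> u" by auto
    then obtain T \<tau> where T: "(T, \<tau>) \<in> A" "u \<in> T"
      using cover cD(2) by blast
    note tc = A[OF T(1)] and tD = is_chartD[OF A[OF T(1)]]
    define W where "W = U \<inter> V \<inter> T"
    have W: "openin X W"
      using cD(1) dD(1) tD(1) by (auto simp: W_def)
    have o: "openin (Euclidean_space n) (\<phi> ` W)" "openin (Euclidean_space n) (\<phi> ` (U \<inter> T))"
      "openin (Euclidean_space n) (\<tau> ` (T \<inter> V))"
      using W cD(1) dD(1) tD(1)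
      by (auto intro!: chart_image_open[OF cc] chart_image_open[OF tc] simp: W_def)
    have s1: "smooth_euclidean n n (\<phi> ` (U \<inter> T)) (\<tau> \<circ> inv_into U \<phi>)"
      and s2: "smooth_euclidean n n (\<tau> ` (T \<inter> V)) (\<psi> \<circ> inv_into T \<tau>)"
      using c d T(1) by (auto simp: compatible_charts_def compatible_def smooth_transition_def)
    have "smooth_euclidean n n (\<phi> ` W) (\<tau> \<circ> inv_into U \<phi>)"
      by (rule smooth_euclidean_subset[OF o(2,1) _ s1]) (auto simp: W_def)
    then have "smooth_euclidean n n (\<phi> ` W) (\<lambda>x. (\<psi> \<circ> inv_into T \<tau>) ((\<tau> \<circ> inv_into U \<phi>) x))"
      by (rule smooth_euclidean_compose[OF o(1,3) _ s2]) (use cD(3) in \<open>auto simp: W_def\<close>)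
    then have "smooth_euclidean n n (\<phi> ` W) (\<psi> \<circ> inv_into U \<phi>)"
      by (rule smooth_euclidean_cong[OF o(1), rotated]) (use cD(3) tD(3) in \<open>auto simp: W_def\<close>)
    then show "\<exists>W'. openin (Euclidean_space n) W' \<and> x \<in> W' \<and> W' \<subseteq> \<phi> ` (U \<inter> V) \<and>
        smooth_euclidean n n W' (\<psi> \<circ> inv_into U \<phi>)"
      using u T(2) o(1) by (intro exI[of _ "\<phi> ` W"]) (auto simp: W_def)
  qed
qed

lemma compatible_charts_maximal:
  assumes A: "\<And>d. d \<in> A \<Longrightarrow> is_chart X n d" "topspace X \<subseteq> (\<Union>(U, \<phi>)\<in>A. U)"
    and pairwise: "\<And>c d. c \<in> A \<Longrightarrow> d \<in> A \<Longrightarrow> smooth_transition n c d"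
  shows "compatible_charts X n (compatible_charts X n A) = compatible_charts X n A"
proof
  have "A \<subseteq> compatible_charts X n A"
    using A(1) pairwise by (auto simp: compatible_charts_def compatible_def)
  then show "compatible_charts X n (compatible_charts X n A) \<subseteq> compatible_charts X n A"
    by (auto simp: compatible_charts_def)
  have "compatible n c d" if "c \<in> compatible_charts X n A" "d \<in> compatible_charts X n A" for c d
    using that smooth_transition_via_atlas[OF A] by (cases c; cases d) (auto simp: compatible_def)
  then show "compatible_charts X n A \<subseteq> compatible_charts X n (compatible_charts X n A)"
    by (auto simp: compatible_charts_def)
qed

definition smooth_structure :: "'a manifold \<Rightarrow> bool" where
  "smooth_structure M \<longleftrightarrow>
     (\<Union>(U, \<phi>)\<in>atlas M. U) = points M \<and> atlas M = compatible_charts (mtop M) (mdim M) (atlas M)"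

lemma smooth_manifold_structure: "smooth_manifold M \<Longrightarrow> smooth_structure M"
  unfolding smooth_manifold_def smooth_structure_def by blast

lemma atlas_is_chart:
  assumes "smooth_structure M" "c \<in> atlas M"
  shows "is_chart (mtop M) (mdim M) c"
  using assms unfolding smooth_structure_def compatible_charts_def by blast

lemma atlas_smooth_transition:
  assumes "smooth_structure M" "c \<in> atlas M" "d \<in> atlas M"
  shows "smooth_transition (mdim M) c d"
  using assms unfolding smooth_structure_def compatible_charts_def compatible_def by blast

lemma atlas_cover:
  assumes "smooth_structure M" "p \<in> points M"
  obtains U \<phi> where "(U, \<phi>) \<in> atlas M" "p \<in> U"
  using assms unfolding smooth_structure_def by blast

lemma atlas_restrict:
  assumes M: "smooth_structure M" and "(U, \<phi>) \<in> atlas M" "openin (mtop M) U'" "U' \<subseteq> U"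
  shows "(U', restrict \<phi> U') \<in> atlas M"
  using compatible_charts_restrict[of U \<phi> "mtop M" "mdim M" "atlas M" U'] assms atlas_is_chart[OF M]
  unfolding smooth_structure_def by blast

section \<open>Smooth maps\<close>

lemma smooth_mapE:
  assumes "smooth_map M N f" "p \<in> points M"
  obtains U \<phi> V \<psi> where "(U, \<phi>) \<in> atlas M" "(V, \<psi>) \<in> atlas N" "p \<in> U" "f ` U \<subseteq> V"
    "smooth_euclidean (mdim M) (mdim N) (\<phi> ` U) (\<lambda>x. \<psi> (f (inv_into U \<phi> x)))"
proof -
  obtain U \<phi> V \<psi> where "(U, \<phi>) \<in> atlas M" "(V, \<psi>) \<in> atlas N" "p \<in> U" "f ` U \<subseteq> V"
    "smooth_euclidean (mdim M) (mdim N) (\<phi> ` U) (\<psi> \<circ> f \<circ> inv_into U \<phi>)"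
    using assms unfolding smooth_map_def by blast
  then show ?thesis
    by (intro that[of U \<phi> V \<psi>]) (auto simp: comp_def)
qed

lemma smooth_map_in_points: "smooth_map M N f \<Longrightarrow> p \<in> points M \<Longrightarrow> f p \<in> points N"
  by (auto simp: smooth_map_def)

text \<open>
  Unlike the definition of smooth maps, this allows to shrink the domain of the source chart.
\<close>

definition smooth_at :: "'a manifold \<Rightarrow> 'b manifold \<Rightarrow> ('a \<Rightarrow> 'b) \<Rightarrow> 'a \<Rightarrow> bool" where
  "smooth_at M N f p \<longleftrightarrow> (\<exists>U \<phi> V \<psi> U'. (U, \<phi>) \<in> atlas M \<and> (V, \<psi>) \<in> atlas N \<and>
     openin (mtop M) U' \<and> p \<in> U' \<and> U' \<subseteq> U \<and> f ` U' \<subseteq> V \<and>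
     smooth_euclidean (mdim M) (mdim N) (\<phi> ` U') (\<lambda>x. \<psi> (f (inv_into U \<phi> x))))"

lemma smooth_atI:
  assumes "(U, \<phi>) \<in> atlas M" "(V, \<psi>) \<in> atlas N" "openin (mtop M) U'" "p \<in> U'" "U' \<subseteq> U" "f ` U' \<subseteq> V"
    and "smooth_euclidean (mdim M) (mdim N) (\<phi> ` U') (\<lambda>x. \<psi> (f (inv_into U \<phi> x)))"
  shows "smooth_at M N f p"
  unfolding smooth_at_def by (intro exI conjI) (rule assms)+

lemma smooth_mapI:
  assumes M: "smooth_structure M" and "f \<in> points M \<rightarrow> points N"
    and loc: "\<And>p. p \<in> points M \<Longrightarrow> smooth_at M N f p"
  shows "smooth_map M N f"
  unfolding smooth_map_def
proof (intro conjI ballI)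
  fix p assume "p \<in> points M"
  from loc[OF this] obtain U \<phi> V \<psi> U' where
    *: "(U, \<phi>) \<in> atlas M" "(V, \<psi>) \<in> atlas N" "openin (mtop M) U'" "p \<in> U'" "U' \<subseteq> U" "f ` U' \<subseteq> V"
      "smooth_euclidean (mdim M) (mdim N) (\<phi> ` U') (\<lambda>x. \<psi> (f (inv_into U \<phi> x)))"
    unfolding smooth_at_def by (elim exE conjE) (rule that)
  note c = atlas_is_chart[OF M *(1)]
  note cD = is_chartD[OF c]
  have inj: "inj_on (restrict \<phi> U') U'"
    using cD(3) *(5) by (auto simp: inj_on_def)
  have eq: "inv_into U' (restrict \<phi> U') (\<phi> u) = u" "inv_into U \<phi> (\<phi> u) = u" if "u \<in> U'" for u
    using inv_into_f_f[OF inj that] that cD(3) *(5) by auto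
  have "smooth_euclidean (mdim M) (mdim N) (\<phi> ` U') (\<psi> \<circ> f \<circ> inv_into U' (restrict \<phi> U'))"
    by (rule smooth_euclidean_cong[OF chart_image_open[OF c *(3,5)] _ *(7)]) (auto simp: eq)
  moreover have "restrict \<phi> U' ` U' = \<phi> ` U'"
    by auto
  ultimately have "smooth_euclidean (mdim M) (mdim N) (restrict \<phi> U' ` U') (\<psi> \<circ> f \<circ> inv_into U' (restrict \<phi> U'))"
    by simp
  then show "\<exists>U \<phi> V \<psi>. (U, \<phi>) \<in> atlas M \<and> (V, \<psi>) \<in> atlas N \<and> p \<in> U \<and> f ` U \<subseteq> V \<and>
      smooth_euclidean (mdim M) (mdim N) (\<phi> ` U) (\<psi> \<circ> f \<circ> inv_into U \<phi>)"
    by (intro exI conjI) (rule atlas_restrict[OF M *(1,3,5)] *(2,4,6) | assumption)+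
qed (use assms in auto)

lemma smooth_map_openin_preimage:
  assumes M: "smooth_structure M" and N: "smooth_structure N"
    and f: "smooth_map M N f" and T: "openin (mtop N) T"
  shows "openin (mtop M) {x \<in> points M. f x \<in> T}"
proof (subst openin_subopen, intro ballI)
  fix p assume p: "p \<in> {x \<in> points M. f x \<in> T}"
  then have "p \<in> points M" by simp
  from smooth_mapE[OF f this] obtain U \<phi> V \<psi> where *: "(U, \<phi>) \<in> atlas M" "(V, \<psi>) \<in> atlas N" "p \<in> U" "f ` U \<subseteq> V"
    "smooth_euclidean (mdim M) (mdim N) (\<phi> ` U) (\<lambda>x. \<psi> (f (inv_into U \<phi> x)))" .
  note cD = is_chartD[OF atlas_is_chart[OF M *(1)]] and dD = is_chartD[OF atlas_is_chart[OF N *(2)]]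
  have "continuous_map (subtopology (Euclidean_space (mdim M)) (\<phi> ` U)) (Euclidean_space (mdim N))
      (\<lambda>x. \<psi> (f (inv_into U \<phi> x)))"
    using *(4) cD(3) dD(7) by (intro smooth_euclidean_continuous_map[OF cD(4) *(5)]) (auto simp: image_subset_iff)
  from continuous_map_compose[OF homeomorphic_imp_continuous_map[OF cD(5)] this]
  have "continuous_map (subtopology (mtop M) U) (Euclidean_space (mdim N)) (\<lambda>x. \<psi> (f x))"
    by (rule continuous_map_eq) (use cD(3) in auto)
  moreover have "openin (Euclidean_space (mdim N)) (\<psi> ` (V \<inter> T))"
    using T dD(1) by (intro chart_image_open[OF atlas_is_chart[OF N *(2)]]) auto
  ultimately have "openin (subtopology (mtop M) U) {x \<in> topspace (subtopology (mtop M) U). \<psi> (f x) \<in> \<psi> ` (V \<inter> T)}"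
    by (rule openin_continuous_map_preimage)
  moreover have "{x \<in> topspace (subtopology (mtop M) U). \<psi> (f x) \<in> \<psi> ` (V \<inter> T)} = {x \<in> U. f x \<in> T}"
  proof -
    have "\<psi> (f x) \<in> \<psi> ` (V \<inter> T) \<longleftrightarrow> f x \<in> T" if "x \<in> U" for x
      using inj_on_image_mem_iff[OF dD(3), of "f x" "V \<inter> T"] *(4) that by auto
    then show ?thesis
      using cD(2) by auto
  qed
  ultimately have "openin (mtop M) {x \<in> U. f x \<in> T}"
    using cD(1) by (simp add: openin_open_subtopology)
  then show "\<exists>T'. openin (mtop M) T' \<and> p \<in> T' \<and> T' \<subseteq> {x \<in> points M. f x \<in> T}"
    using p *(3) cD(2) by (intro exI[of _ "{x \<in> U. f x \<in> T}"]) auto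
qed

lemma smooth_map_compose:
  assumes M: "smooth_structure M" and N: "smooth_structure N"
    and f: "smooth_map M N f" and g: "smooth_map N P g"
  shows "smooth_map M P (\<lambda>x. g (f x))"
proof (rule smooth_mapI[OF M])
  show "(\<lambda>x. g (f x)) \<in> points M \<rightarrow> points P"
    using f g by (auto simp: smooth_map_in_points)
  fix p assume p: "p \<in> points M"
  obtain U \<phi> V \<psi> where *: "(U, \<phi>) \<in> atlas M" "(V, \<psi>) \<in> atlas N" "p \<in> U" "f ` U \<subseteq> V"
    "smooth_euclidean (mdim M) (mdim N) (\<phi> ` U) (\<lambda>x. \<psi> (f (inv_into U \<phi> x)))"
    using smooth_mapE[OF f p] .
  obtain V' \<psi>' T \<tau> where cc: "(V', \<psi>') \<in> atlas N" "(T, \<tau>) \<in> atlas P" "f p \<in> V'" "g ` V' \<subseteq> T"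
    "smooth_euclidean (mdim N) (mdim P) (\<psi>' ` V') (\<lambda>x. \<tau> (g (inv_into V' \<psi>' x)))"
    using smooth_mapE[OF g smooth_map_in_points[OF f p]] .
  note c = atlas_is_chart[OF M *(1)] and d = atlas_is_chart[OF N *(2)] and d' = atlas_is_chart[OF N cc(1)]
  note cD = is_chartD[OF c] and dD = is_chartD[OF d] and dD' = is_chartD[OF d']
  define U' where "U' = U \<inter> {x \<in> points M. f x \<in> V'}"
  have U': "openin (mtop M) U'" "U' \<subseteq> U" "p \<in> U'" "\<And>u. u \<in> U' \<Longrightarrow> u \<in> U \<and> f u \<in> V \<and> f u \<in> V'"
    using smooth_map_openin_preimage[OF M N f dD'(1)] cD(1) *(3,4) cc(3) p by (auto simp: U'_def)
  have o: "openin (Euclidean_space (mdim M)) (\<phi> ` U')" "openin (Euclidean_space (mdim N)) (\<psi> ` (V \<inter> V'))"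
    using U' dD(1) dD'(1) by (auto intro!: chart_image_open[OF c] chart_image_open[OF d])
  have "smooth_euclidean (mdim N) (mdim N) (\<psi> ` (V \<inter> V')) (\<lambda>y. \<psi>' (inv_into V \<psi> y))"
    using atlas_smooth_transition[OF N *(2) cc(1)] by (simp add: smooth_transition_def comp_def)
  then have s2: "smooth_euclidean (mdim N) (mdim P) (\<psi> ` (V \<inter> V')) (\<lambda>y. \<tau> (g (inv_into V' \<psi>' (\<psi>' (inv_into V \<psi> y)))))"
    by (rule smooth_euclidean_compose[OF o(2) dD'(4) _ cc(5)]) (use dD(3) in auto)
  have s1: "smooth_euclidean (mdim M) (mdim N) (\<phi> ` U') (\<lambda>x. \<psi> (f (inv_into U \<phi> x)))"
    using U'(2) by (intro smooth_euclidean_subset[OF cD(4) o(1) _ *(5)]) auto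
  have "smooth_euclidean (mdim M) (mdim P) (\<phi> ` U')
      (\<lambda>x. \<tau> (g (inv_into V' \<psi>' (\<psi>' (inv_into V \<psi> (\<psi> (f (inv_into U \<phi> x))))))))"
    by (rule smooth_euclidean_compose[OF o s1 s2]) (use U'(4) cD(3) in auto)
  then have "smooth_euclidean (mdim M) (mdim P) (\<phi> ` U') (\<lambda>x. \<tau> (g (f (inv_into U \<phi> x))))"
    by (rule smooth_euclidean_cong[OF o(1), rotated]) (use U'(4) cD(3) dD(3) dD'(3) in auto)
  moreover have "(\<lambda>x. g (f x)) ` U' \<subseteq> T"
    using U'(4) cc(4) by (simp add: image_subset_iff)
  ultimately show "smooth_at M P (\<lambda>x. g (f x)) p"
    by (rule smooth_atI[OF *(1) cc(2) U'(1,3,2), rotated])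
qed

lemma smooth_map_cong:
  assumes M: "smooth_structure M" and f: "smooth_map M N f" and eq: "\<And>x. x \<in> points M \<Longrightarrow> f x = g x"
  shows "smooth_map M N g"
proof (rule smooth_mapI[OF M])
  show "g \<in> points M \<rightarrow> points N"
    using smooth_map_in_points[OF f] eq by auto
  fix p assume p: "p \<in> points M"
  obtain U \<phi> V \<psi> where *: "(U, \<phi>) \<in> atlas M" "(V, \<psi>) \<in> atlas N" "p \<in> U" "f ` U \<subseteq> V"
    "smooth_euclidean (mdim M) (mdim N) (\<phi> ` U) (\<lambda>x. \<psi> (f (inv_into U \<phi> x)))"
    using smooth_mapE[OF f p] .
  note cD = is_chartD[OF atlas_is_chart[OF M *(1)]]
  have eq': "g u = f u" if "u \<in> U" for u
    using eq cD(2) that by auto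
  have "smooth_euclidean (mdim M) (mdim N) (\<phi> ` U) (\<lambda>x. \<psi> (g (inv_into U \<phi> x)))"
    by (rule smooth_euclidean_cong[OF cD(4) _ *(5)]) (use cD(3) in \<open>auto simp: eq'\<close>)
  moreover have "g ` U \<subseteq> V"
    using *(4) eq' by auto
  ultimately show "smooth_at M N g p"
    by (rule smooth_atI[OF *(1,2) cD(1) *(3) subset_refl, rotated])
qed

lemma smooth_map_id:
  assumes M: "smooth_structure M"
  shows "smooth_map M M (\<lambda>x. x)"
proof (rule smooth_mapI[OF M])
  fix p assume p: "p \<in> points M"
  obtain U \<phi> where *: "(U, \<phi>) \<in> atlas M" "p \<in> U"
    using atlas_cover[OF M p] .
  note cD = is_chartD[OF atlas_is_chart[OF M *(1)]]
  have "smooth_euclidean (mdim M) (mdim M) (\<phi> ` U) (\<lambda>x. \<phi> (inv_into U \<phi> x))"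
    by (rule smooth_euclidean_cong[OF cD(4) _ smooth_euclidean_id[OF cD(4)]]) (use cD(3) in auto)
  then show "smooth_at M M (\<lambda>x. x) p"
    by (intro smooth_atI[OF *(1) *(1) cD(1) *(2)]) auto
qed auto

lemma smooth_map_const:
  assumes M: "smooth_structure M" and N: "smooth_structure N" and q: "q \<in> points N"
  shows "smooth_map M N (\<lambda>x. q)"
proof (rule smooth_mapI[OF M])
  fix p assume p: "p \<in> points M"
  obtain U \<phi> where *: "(U, \<phi>) \<in> atlas M" "p \<in> U"
    using atlas_cover[OF M p] .
  obtain V \<psi> where cc: "(V, \<psi>) \<in> atlas N" "q \<in> V"
    using atlas_cover[OF N q] .
  note cD = is_chartD[OF atlas_is_chart[OF M *(1)]]
  show "smooth_at M N (\<lambda>x. q) p"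
    by (rule smooth_atI[OF *(1) cc(1) cD(1) *(2) subset_refl]) (use cc smooth_euclidean_const[OF cD(4)] in auto)
qed (use q in auto)

section \<open>Products\<close>

lemma product_chart_eq:
  "product_chart m (U, \<phi>) (V, \<psi>) = (U \<times> V, \<lambda>z\<in>U \<times> V. join_coords m (\<phi> (fst z)) (\<psi> (snd z)))"
  by (auto simp: product_chart_def restrict_def fun_eq_iff)

lemma is_chart_product:
  assumes c: "is_chart X m (U, \<phi>)" and d: "is_chart Y n (V, \<psi>)"
  shows "is_chart (prod_topology X Y) (m + n) (product_chart m (U, \<phi>) (V, \<psi>))"
proof -
  note cD = is_chartD[OF c] and dD = is_chartD[OF d]
  define F where "F z = join_coords m (\<phi> (fst z)) (\<psi> (snd z))" for z
  define G where "G w = (inv_into U \<phi> (left_coords m w), inv_into V \<psi> (right_coords m w))" for w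
  define W where "W = {w \<in> topspace (Euclidean_space (m + n)). left_coords m w \<in> \<phi> ` U} \<inter>
      {w \<in> topspace (Euclidean_space (m + n)). right_coords m w \<in> \<psi> ` V}"
  have FW: "F z \<in> W" "G (F z) = z" if "z \<in> U \<times> V" for z
  proof -
    have "\<phi> (fst z) \<in> topspace (Euclidean_space m)" "\<psi> (snd z) \<in> topspace (Euclidean_space n)"
      using that cD(7) dD(7) by auto
    then show "F z \<in> W" "G (F z) = z"
      using that join_coords_in_Euclidean_space cD(3) dD(3) by (auto simp: F_def G_def W_def)
  qed
  have GW: "G w \<in> U \<times> V" "F (G w) = w" if "w \<in> W" for w
    using that by (auto simp: F_def G_def W_def inv_into_into f_inv_into_f)
  have im: "F ` (U \<times> V) = W"
    using FW GW by (metis image_eqI subsetI subset_antisym image_subsetI)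
  have W: "openin (Euclidean_space (m + n)) W"
    unfolding W_def using cD(4) dD(4)
    by (intro openin_Int openin_continuous_map_preimage[OF continuous_map_left_coords]
        openin_continuous_map_preimage[OF continuous_map_right_coords])
  have "continuous_map (prod_topology (subtopology X U) (subtopology Y V)) (Euclidean_space (m + n)) F"
  proof (rule continuous_map_Euclidean_space)
    show "F \<in> topspace (prod_topology (subtopology X U) (subtopology Y V)) \<rightarrow> topspace (Euclidean_space (m + n))"
      using FW(1) openin_subset[OF W] by fastforce
    fix i assume "i < m + n"
    have proj: "continuous_map (Euclidean_space k) euclideanreal (\<lambda>x. x j)" for j k
      unfolding Euclidean_space_def
      by (intro continuous_map_from_subtopology continuous_map_product_projection) auto
    note c1 = continuous_map_compose[OF continuous_map_compose[OF continuous_map_fst cD(6)] proj]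
    note c2 = continuous_map_compose[OF continuous_map_compose[OF continuous_map_snd dD(6)] proj]
    show "continuous_map (prod_topology (subtopology X U) (subtopology Y V)) euclideanreal (\<lambda>x. F x i)"
      using c1[of "subtopology Y V" i] c2[of "subtopology X U" "i - m"]
      by (cases "i < m") (simp_all add: F_def join_coords_def comp_def)
  qed
  then have "continuous_map (subtopology (prod_topology X Y) (U \<times> V)) (subtopology (Euclidean_space (m + n)) W) F"
    using FW by (auto simp: subtopology_Times continuous_map_in_subtopology)
  moreover have "continuous_map (subtopology (Euclidean_space (m + n)) W) (subtopology (prod_topology X Y) (U \<times> V)) G"
  proof -
    have l: "continuous_map (subtopology (Euclidean_space (m + n)) W) (subtopology (Euclidean_space m) (\<phi> ` U)) (left_coords m)"
      and r: "continuous_map (subtopology (Euclidean_space (m + n)) W) (subtopology (Euclidean_space n) (\<psi> ` V)) (right_coords m)"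
      by (auto simp: continuous_map_in_subtopology W_def
          intro!: continuous_map_from_subtopology continuous_map_left_coords continuous_map_right_coords)
    have "continuous_map (subtopology (Euclidean_space (m + n)) W) (prod_topology X Y) G"
      using continuous_map_pairedI[OF continuous_map_compose[OF l chart_inv_continuous_map[OF c]]
          continuous_map_compose[OF r chart_inv_continuous_map[OF d]]]
      by (simp add: G_def[abs_def] comp_def)
    then show ?thesis
      using GW(1) by (auto simp: continuous_map_in_subtopology)
  qed
  ultimately have "homeomorphic_maps (subtopology (prod_topology X Y) (U \<times> V)) (subtopology (Euclidean_space (m + n)) W) F G"
    using FW(2) GW(2) by (auto simp: homeomorphic_maps_def)
  then have "homeomorphic_map (subtopology (prod_topology X Y) (U \<times> V)) (subtopology (Euclidean_space (m + n)) W) F"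
    by (rule homeomorphic_maps_imp_map)
  then have "homeomorphic_map (subtopology (prod_topology X Y) (U \<times> V)) (subtopology (Euclidean_space (m + n)) W)
      (restrict F (U \<times> V))"
    by (rule homeomorphic_map_eq) auto
  moreover have "restrict F (U \<times> V) ` (U \<times> V) = W"
    using im by auto
  ultimately show ?thesis
    using W cD(1) dD(1) unfolding product_chart_eq F_def[symmetric]
    by (simp add: is_chart_def openin_prod_Times_iff)
qed

lemma product_chart_inv:
  assumes c: "is_chart X m (U, \<phi>)" and d: "is_chart Y n (V, \<psi>)" and "u \<in> U" "v \<in> V"
  shows "inv_into (U \<times> V) (snd (product_chart m (U, \<phi>) (V, \<psi>))) (join_coords m (\<phi> u) (\<psi> v)) = (u, v)"
proof -
  have "is_chart (prod_topology X Y) (m + n) (U \<times> V, snd (product_chart m (U, \<phi>) (V, \<psi>)))"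
    using is_chart_product[OF c d] by (simp add: product_chart_eq)
  from inv_into_f_f[OF is_chartD(3)[OF this], of "(u, v)"] show ?thesis
    using assms(3,4) by (simp add: product_chart_eq)
qed

lemma smooth_transition_product:
  assumes c1: "is_chart X m (U1, \<phi>1)" and d1: "is_chart Y n (V1, \<psi>1)"
    and c2: "is_chart X m (U2, \<phi>2)" and d2: "is_chart Y n (V2, \<psi>2)"
    and c: "smooth_transition m (U1, \<phi>1) (U2, \<phi>2)" and d: "smooth_transition n (V1, \<psi>1) (V2, \<psi>2)"
  shows "smooth_transition (m + n) (product_chart m (U1, \<phi>1) (V1, \<psi>1)) (product_chart m (U2, \<phi>2) (V2, \<psi>2))"
proof -
  note cD1 = is_chartD[OF c1] and dD1 = is_chartD[OF d1] and cD2 = is_chartD[OF c2] and dD2 = is_chartD[OF d2]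
  define F1 where "F1 = snd (product_chart m (U1, \<phi>1) (V1, \<psi>1))"
  define F2 where "F2 = snd (product_chart m (U2, \<phi>2) (V2, \<psi>2))"
  define D where "D = (U1 \<inter> U2) \<times> (V1 \<inter> V2)"
  have F1: "F1 (u, v) = join_coords m (\<phi>1 u) (\<psi>1 v)" if "u \<in> U1" "v \<in> V1" for u v
    using that by (simp add: F1_def product_chart_eq)
  have F2: "F2 (u, v) = join_coords m (\<phi>2 u) (\<psi>2 v)" if "u \<in> U2" "v \<in> V2" for u v
    using that by (simp add: F2_def product_chart_eq)
  have inv: "inv_into (U1 \<times> V1) F1 (F1 (u, v)) = (u, v)" if "u \<in> U1" "v \<in> V1" for u v
    using product_chart_inv[OF c1 d1 that] F1[OF that] by (simp add: F1_def)
  have "is_chart (prod_topology X Y) (m + n) (U1 \<times> V1, F1)"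
    using is_chart_product[OF c1 d1] by (simp add: F1_def product_chart_eq)
  moreover have "openin (prod_topology X Y) D"
    using cD1(1) dD1(1) cD2(1) dD2(1) by (auto simp: D_def openin_prod_Times_iff)
  ultimately have W: "openin (Euclidean_space (m + n)) (F1 ` D)"
    by (rule chart_image_open) (auto simp: D_def)
  have \<phi>1: "\<phi>1 u \<in> topspace (Euclidean_space m)" if "u \<in> U1" for u
    using that cD1(7) by auto
  have oc: "openin (Euclidean_space m) (\<phi>1 ` (U1 \<inter> U2))" and od: "openin (Euclidean_space n) (\<psi>1 ` (V1 \<inter> V2))"
    using cD1(1) dD1(1) cD2(1) dD2(1) by (auto intro!: chart_image_open[OF c1] chart_image_open[OF d1])
  have "smooth_euclidean m m (\<phi>1 ` (U1 \<inter> U2)) (\<phi>2 \<circ> inv_into U1 \<phi>1)"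
    "smooth_euclidean n n (\<psi>1 ` (V1 \<inter> V2)) (\<psi>2 \<circ> inv_into V1 \<psi>1)"
    using c d by (auto simp: smooth_transition_def)
  note s = smooth_euclidean_compose[OF W oc smooth_left_coords[OF W] this(1)]
    smooth_euclidean_compose[OF W od smooth_right_coords[OF W] this(2)]
  have "smooth_euclidean (m + n) m (F1 ` D) (\<lambda>z. (\<phi>2 \<circ> inv_into U1 \<phi>1) (left_coords m z))"
    by (rule s(1)) (use \<phi>1 in \<open>auto simp: D_def F1\<close>)
  moreover have "smooth_euclidean (m + n) n (F1 ` D) (\<lambda>z. (\<psi>2 \<circ> inv_into V1 \<psi>1) (right_coords m z))"
    by (rule s(2)) (auto simp: D_def F1)
  ultimately have "smooth_euclidean (m + n) (m + n) (F1 ` D) (\<lambda>z. join_coords m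
      ((\<phi>2 \<circ> inv_into U1 \<phi>1) (left_coords m z)) ((\<psi>2 \<circ> inv_into V1 \<psi>1) (right_coords m z)))"
    by (rule smooth_join_coords)
  then have "smooth_euclidean (m + n) (m + n) (F1 ` D) (F2 \<circ> inv_into (U1 \<times> V1) F1)"
    by (rule smooth_euclidean_cong[OF W, rotated])
      (use \<phi>1 cD1(3) dD1(3) in \<open>auto simp: D_def inv F2, auto simp: F1\<close>)
  moreover have "D = (U1 \<times> V1) \<inter> (U2 \<times> V2)"
    by (auto simp: D_def)
  ultimately show ?thesis
    by (simp add: smooth_transition_def F1_def F2_def product_chart_eq)
qed

lemma product_manifold_simps [simp]:
  "mtop (product_manifold M N) = prod_topology (mtop M) (mtop N)"
  "mdim (product_manifold M N) = mdim M + mdim N"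
  by (simp_all add: product_manifold_def)

context
  fixes M :: "'a manifold" and N :: "'b manifold"
  assumes M: "smooth_structure M" and N: "smooth_structure N"
begin

lemma product_chart_in_atlas:
  assumes "c \<in> atlas M" "d \<in> atlas N"
  shows "product_chart (mdim M) c d \<in> atlas (product_manifold M N)"
proof -
  have "smooth_transition (mdim M + mdim N) (product_chart (mdim M) c1 d1) (product_chart (mdim M) c2 d2)"
    if "c1 \<in> atlas M" "d1 \<in> atlas N" "c2 \<in> atlas M" "d2 \<in> atlas N" for c1 d1 c2 d2
    using that atlas_is_chart[OF M] atlas_is_chart[OF N] atlas_smooth_transition[OF M] atlas_smooth_transition[OF N]
    by (cases c1; cases d1; cases c2; cases d2) (auto intro!: smooth_transition_product)
  then have "compatible (mdim M + mdim N) (product_chart (mdim M) c d) e"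
    if "\<exists>c' d'. e = product_chart (mdim M) c' d' \<and> c' \<in> atlas M \<and> d' \<in> atlas N" for e
    using assms that unfolding compatible_def by metis
  moreover have "is_chart (prod_topology (mtop M) (mtop N)) (mdim M + mdim N) (product_chart (mdim M) c d)"
    using assms atlas_is_chart[OF M] atlas_is_chart[OF N] is_chart_product by (metis surj_pair)
  ultimately show ?thesis
    by (simp add: product_manifold_def compatible_charts_def)
qed

lemma smooth_structure_product: "smooth_structure (product_manifold M N)"
proof -
  define A where "A = {product_chart (mdim M) c d | c d. c \<in> atlas M \<and> d \<in> atlas N}"
  have atl: "atlas (product_manifold M N) = compatible_charts (prod_topology (mtop M) (mtop N)) (mdim M + mdim N) A"
    by (simp add: product_manifold_def A_def)
  have sub: "A \<subseteq> atlas (product_manifold M N)"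
    using product_chart_in_atlas by (auto simp: A_def)
  then have A: "is_chart (prod_topology (mtop M) (mtop N)) (mdim M + mdim N) d" if "d \<in> A" for d
    using that unfolding atl compatible_charts_def by auto
  have tr: "smooth_transition (mdim M + mdim N) c d" if "c \<in> A" "d \<in> A" for c d
  proof -
    have "compatible (mdim M + mdim N) c d"
      using subsetD[OF sub that(1)] that(2) unfolding atl compatible_charts_def by simp
    then show ?thesis
      by (simp add: compatible_def)
  qed
  have cover: "topspace (prod_topology (mtop M) (mtop N)) \<subseteq> (\<Union>(U, \<phi>)\<in>A. U)"
  proof
    fix p assume "p \<in> topspace (prod_topology (mtop M) (mtop N))"
    then obtain a b where p: "p = (a, b)" "a \<in> points M" "b \<in> points N"
      by auto
    obtain U \<phi> where *: "(U, \<phi>) \<in> atlas M" "a \<in> U"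
      using atlas_cover[OF M p(2)] .
    obtain V \<psi> where cc: "(V, \<psi>) \<in> atlas N" "b \<in> V"
      using atlas_cover[OF N p(3)] .
    have "product_chart (mdim M) (U, \<phi>) (V, \<psi>) \<in> A"
      using * cc by (auto simp: A_def)
    moreover have "p \<in> fst (product_chart (mdim M) (U, \<phi>) (V, \<psi>))"
      using *(2) cc(2) p(1) by (simp add: product_chart_eq)
    ultimately show "p \<in> (\<Union>(U, \<phi>)\<in>A. U)"
      by (auto simp: case_prod_beta)
  qed
  have "(\<Union>(U, \<phi>)\<in>atlas (product_manifold M N). U) \<subseteq> topspace (prod_topology (mtop M) (mtop N))"
  proof (rule UN_least)
    fix c assume c: "c \<in> atlas (product_manifold M N)"
    obtain U \<phi> where U: "c = (U, \<phi>)" by (cases c)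
    have "is_chart (prod_topology (mtop M) (mtop N)) (mdim M + mdim N) (U, \<phi>)"
      using c unfolding U atl compatible_charts_def by simp
    from is_chartD(2)[OF this] U show "(case c of (U, \<phi>) \<Rightarrow> U) \<subseteq> topspace (prod_topology (mtop M) (mtop N))"
      by simp
  qed
  moreover have "(\<Union>(U, \<phi>)\<in>A. U) \<subseteq> (\<Union>(U, \<phi>)\<in>atlas (product_manifold M N). U)"
    using sub by (rule UN_mono) simp
  ultimately have "(\<Union>(U, \<phi>)\<in>atlas (product_manifold M N). U) = points (product_manifold M N)"
    using cover by (simp only: product_manifold_simps)
  then show ?thesis
    using compatible_charts_maximal[OF A cover tr] by (simp add: smooth_structure_def atl)
qed

lemma smooth_map_fst: "smooth_map (product_manifold M N) M fst"
  and smooth_map_snd: "smooth_map (product_manifold M N) N snd"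
proof -
  let ?P = "product_manifold M N"
  have *: "smooth_at ?P M fst p \<and> smooth_at ?P N snd p"
    if in_P: "p \<in> points ?P" for p
  proof -
    obtain a b where p: "p = (a, b)" "a \<in> points M" "b \<in> points N"
      using in_P by auto
    obtain U \<phi> where c: "(U, \<phi>) \<in> atlas M" "a \<in> U"
      using atlas_cover[OF M p(2)] .
    obtain V \<psi> where d: "(V, \<psi>) \<in> atlas N" "b \<in> V"
      using atlas_cover[OF N p(3)] .
    note cc = atlas_is_chart[OF M c(1)] and dc = atlas_is_chart[OF N d(1)]
    note cD = is_chartD[OF cc] and dD = is_chartD[OF dc]
    define F where "F = snd (product_chart (mdim M) (U, \<phi>) (V, \<psi>))"
    have at: "(U \<times> V, F) \<in> atlas ?P"
      using product_chart_in_atlas[OF c(1) d(1)] by (simp add: F_def product_chart_eq)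
    note pD = is_chartD[OF atlas_is_chart[OF smooth_structure_product at]]
    have F: "F (u, v) = join_coords (mdim M) (\<phi> u) (\<psi> v)" "inv_into (U \<times> V) F (F (u, v)) = (u, v)"
      if "u \<in> U" "v \<in> V" for u v
      using that product_chart_inv[OF cc dc that] by (simp_all add: F_def product_chart_eq)
    have \<phi>: "\<phi> u \<in> topspace (Euclidean_space (mdim M))" if "u \<in> U" for u
      using that cD(7) by auto
    have "smooth_euclidean (mdim ?P) (mdim M) (F ` (U \<times> V)) (\<lambda>x. \<phi> (fst (inv_into (U \<times> V) F x)))"
      by (rule smooth_euclidean_cong[OF pD(4) _ smooth_left_coords[OF pD(4)]])
        (auto simp: F(2), auto simp: F(1) \<phi>)
    then have "smooth_at ?P M fst p"
      using c d p by (intro smooth_atI[OF at c(1) pD(1)]) auto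
    moreover have "smooth_euclidean (mdim ?P) (mdim N) (F ` (U \<times> V)) (\<lambda>x. \<psi> (snd (inv_into (U \<times> V) F x)))"
      by (rule smooth_euclidean_cong[OF pD(4) _ smooth_right_coords[OF pD(4), of _ "mdim M"]])
        (auto simp: F(2), auto simp: F(1))
    then have "smooth_at ?P N snd p"
      using c d p by (intro smooth_atI[OF at d(1) pD(1)]) auto
    ultimately show ?thesis ..
  qed
  show "smooth_map ?P M fst"
    by (rule smooth_mapI[OF smooth_structure_product]) (use * in auto)
  show "smooth_map ?P N snd"
    by (rule smooth_mapI[OF smooth_structure_product]) (use * in auto)
qed

lemma smooth_map_pair:
  assumes P: "smooth_structure P" and f: "smooth_map P M f" and g: "smooth_map P N g"
  shows "smooth_map P (product_manifold M N) (\<lambda>x. (f x, g x))"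
proof (rule smooth_mapI[OF P])
  show "(\<lambda>x. (f x, g x)) \<in> points P \<rightarrow> points (product_manifold M N)"
    using f g by (auto simp: smooth_map_in_points)
  fix p assume p: "p \<in> points P"
  obtain U \<phi> V \<psi> where *: "(U, \<phi>) \<in> atlas P" "(V, \<psi>) \<in> atlas M" "p \<in> U" "f ` U \<subseteq> V"
    "smooth_euclidean (mdim P) (mdim M) (\<phi> ` U) (\<lambda>x. \<psi> (f (inv_into U \<phi> x)))"
    using smooth_mapE[OF f p] .
  obtain U' \<phi>' V' \<psi>' where cc: "(U', \<phi>') \<in> atlas P" "(V', \<psi>') \<in> atlas N" "p \<in> U'" "g ` U' \<subseteq> V'"
    "smooth_euclidean (mdim P) (mdim N) (\<phi>' ` U') (\<lambda>x. \<psi>' (g (inv_into U' \<phi>' x)))"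
    using smooth_mapE[OF g p] .
  note c = atlas_is_chart[OF P *(1)] and c' = atlas_is_chart[OF P cc(1)]
  note cD = is_chartD[OF c] and cD' = is_chartD[OF c']
  define F where "F = snd (product_chart (mdim M) (V, \<psi>) (V', \<psi>'))"
  have at: "(V \<times> V', F) \<in> atlas (product_manifold M N)"
    using product_chart_in_atlas[OF *(2) cc(2)] by (simp add: F_def product_chart_eq)
  have UU: "openin (mtop P) (U \<inter> U')"
    using cD(1) cD'(1) by auto
  have o: "openin (Euclidean_space (mdim P)) (\<phi> ` (U \<inter> U'))"
    using UU by (intro chart_image_open[OF c]) auto
  have s1: "smooth_euclidean (mdim P) (mdim M) (\<phi> ` (U \<inter> U')) (\<lambda>x. \<psi> (f (inv_into U \<phi> x)))"
    by (rule smooth_euclidean_subset[OF cD(4) o _ *(5)]) auto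
  have "smooth_euclidean (mdim P) (mdim P) (\<phi> ` (U \<inter> U')) (\<lambda>x. \<phi>' (inv_into U \<phi> x))"
    using atlas_smooth_transition[OF P *(1) cc(1)] by (simp add: smooth_transition_def comp_def)
  then have "smooth_euclidean (mdim P) (mdim N) (\<phi> ` (U \<inter> U')) (\<lambda>x. \<psi>' (g (inv_into U' \<phi>' (\<phi>' (inv_into U \<phi> x)))))"
    by (rule smooth_euclidean_compose[OF o cD'(4) _ cc(5)]) (use cD(3) in auto)
  from smooth_join_coords[OF s1 this]
  have "smooth_euclidean (mdim P) (mdim M + mdim N) (\<phi> ` (U \<inter> U')) (\<lambda>x. F (f (inv_into U \<phi> x), g (inv_into U \<phi> x)))"
    by (rule smooth_euclidean_cong[OF o, rotated])
      (use cD(3) cD'(3) *(4) cc(4) in \<open>auto simp: F_def product_chart_eq image_subset_iff\<close>)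
  moreover have "(\<lambda>x. (f x, g x)) ` (U \<inter> U') \<subseteq> V \<times> V'"
    using *(4) cc(4) by auto
  ultimately show "smooth_at P (product_manifold M N) (\<lambda>x. (f x, g x)) p"
    using smooth_atI[OF *(1) at UU] *(3) cc(3) by simp
qed

end

section \<open>Heaps and groups\<close>

definition heap_of_group :: "'a monoid \<Rightarrow> 'a \<times> 'a \<times> 'a \<Rightarrow> 'a" where
  "heap_of_group G = (\<lambda>(x, y, z)\<in>carrier G \<times> carrier G \<times> carrier G. x \<otimes>\<^bsub>G\<^esub> inv\<^bsub>G\<^esub> y \<otimes>\<^bsub>G\<^esub> z)"

definition group_of_heap :: "'a set \<Rightarrow> ('a \<times> 'a \<times> 'a \<Rightarrow> 'a) \<Rightarrow> 'a \<Rightarrow> 'a monoid" where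
  "group_of_heap S \<mu> e =
     \<lparr> carrier = S, mult = curry (\<lambda>(x, y)\<in>S \<times> S. \<mu> (x, e, y)), one = e \<rparr>"

lemma heap_of_group_apply:
  "x \<in> carrier G \<Longrightarrow> y \<in> carrier G \<Longrightarrow> z \<in> carrier G \<Longrightarrow>
     heap_of_group G (x, y, z) = x \<otimes>\<^bsub>G\<^esub> inv\<^bsub>G\<^esub> y \<otimes>\<^bsub>G\<^esub> z"
  by (simp add: heap_of_group_def)

lemma heap_heap_of_group:
  assumes "group G"
  shows "heap (carrier G) (heap_of_group G)"
proof -
  interpret group G by fact
  have closed: "heap_of_group G (x, y, z) \<in> carrier G"
    if "x \<in> carrier G" "y \<in> carrier G" "z \<in> carrier G" for x y z
    using that by (simp add: heap_of_group_apply)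
  have "heap_of_group G \<in> carrier G \<times> carrier G \<times> carrier G \<rightarrow>\<^sub>E carrier G"
    using closed by (auto simp: PiE_iff heap_of_group_def)
  then show ?thesis
    unfolding heap_def semiheap_def
    by (simp add: heap_of_group_apply closed m_assoc inv_mult_group)
qed

lemma group_of_heap_simps [simp]:
  "carrier (group_of_heap S \<mu> e) = S"
  "\<one>\<^bsub>group_of_heap S \<mu> e\<^esub> = e"
  "x \<in> S \<Longrightarrow> y \<in> S \<Longrightarrow> x \<otimes>\<^bsub>group_of_heap S \<mu> e\<^esub> y = \<mu> (x, e, y)"
  by (simp_all add: group_of_heap_def)

context
  fixes S :: "'a set" and \<mu> e
  assumes heap: "heap S \<mu>" and e: "e \<in> S"
begin

lemma heap_closed: "x \<in> S \<Longrightarrow> y \<in> S \<Longrightarrow> z \<in> S \<Longrightarrow> \<mu> (x, y, z) \<in> S"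
  using heap by (auto simp: heap_def semiheap_def PiE_iff)

lemma heap_biunitary: "x \<in> S \<Longrightarrow> y \<in> S \<Longrightarrow> \<mu> (y, x, x) = y" "x \<in> S \<Longrightarrow> y \<in> S \<Longrightarrow> \<mu> (x, x, y) = y"
  using heap by (simp_all add: heap_def)

lemma heap_assoc:
  assumes "x1 \<in> S" "x2 \<in> S" "x3 \<in> S" "x4 \<in> S" "x5 \<in> S"
  shows "\<mu> (\<mu> (x1, x2, x3), x4, x5) = \<mu> (x1, x2, \<mu> (x3, x4, x5))"
  using heap assms unfolding heap_def semiheap_def by metis

lemma group_group_of_heap: "group (group_of_heap S \<mu> e)"
proof (rule groupI)
  fix x assume "x \<in> carrier (group_of_heap S \<mu> e)"
  then show "\<exists>y\<in>carrier (group_of_heap S \<mu> e). y \<otimes>\<^bsub>group_of_heap S \<mu> e\<^esub> x = \<one>\<^bsub>group_of_heap S \<mu> e\<^esub>"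
    using e by (intro bexI[of _ "\<mu> (e, x, e)"]) (simp_all add: heap_closed heap_assoc heap_biunitary)
qed (use e in \<open>simp_all add: heap_closed heap_assoc heap_biunitary\<close>)

lemma inv_group_of_heap:
  assumes "x \<in> S"
  shows "inv\<^bsub>group_of_heap S \<mu> e\<^esub> x = \<mu> (e, x, e)"
proof -
  interpret group "group_of_heap S \<mu> e" by (rule group_group_of_heap)
  show ?thesis
    using assms e by (intro inv_equality) (simp_all add: heap_closed heap_assoc heap_biunitary)
qed

lemma heap_of_group_of_heap: "heap_of_group (group_of_heap S \<mu> e) = \<mu>"
proof -
  have "heap_of_group (group_of_heap S \<mu> e) (x, y, z) = \<mu> (x, y, z)" if "x \<in> S" "y \<in> S" "z \<in> S" for x y z
    using that e by (simp add: heap_of_group_apply inv_group_of_heap heap_closed heap_assoc heap_biunitary)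
      (simp add: heap_assoc[symmetric] heap_closed heap_biunitary)
  moreover have "\<mu> \<in> extensional (S \<times> S \<times> S)"
    using heap by (auto simp: heap_def semiheap_def PiE_iff)
  ultimately show ?thesis
    by (intro extensionalityI[of _ "S \<times> S \<times> S"]) (auto simp: heap_of_group_def)
qed

end

lemma group_of_heap_of_group:
  fixes G :: "'a monoid"
  assumes "group G" and mult_ext: "case_prod (mult G) \<in> extensional (carrier G \<times> carrier G)"
  shows "group_of_heap (carrier G) (heap_of_group G) \<one>\<^bsub>G\<^esub> = G"
proof -
  interpret group G by fact
  have "curry (\<lambda>(x, y)\<in>carrier G \<times> carrier G. heap_of_group G (x, \<one>\<^bsub>G\<^esub>, y)) x y = x \<otimes>\<^bsub>G\<^esub> y" for x y
  proof (cases "x \<in> carrier G \<and> y \<in> carrier G")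
    case True
    then show ?thesis by (simp add: heap_of_group_apply)
  next
    case False
    then show ?thesis
      using extensional_arb[OF mult_ext, of "(x, y)"] by auto
  qed
  then have "curry (\<lambda>(x, y)\<in>carrier G \<times> carrier G. heap_of_group G (x, \<one>\<^bsub>G\<^esub>, y)) = mult G"
    by (intro ext)
  then show ?thesis
    by (simp add: group_of_heap_def)
qed

section \<open>The isomorphism of categories\<close>

lemma lie_groupD:
  assumes "lie_group M G"
  shows "smooth_structure M" "group G" "carrier G = points M"
    "smooth_map (product_manifold M M) M (\<lambda>z. fst z \<otimes>\<^bsub>G\<^esub> snd z)" "smooth_map M M (\<lambda>x. inv\<^bsub>G\<^esub> x)"
  using assms by (auto simp: lie_group_def smooth_manifold_structure case_prod_beta')

lemma pointed_lie_heapD: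
  assumes "pointed_lie_heap M \<mu> e"
  shows "smooth_structure M" "heap (points M) \<mu>" "e \<in> points M"
    "smooth_map (product_manifold M (product_manifold M M)) M \<mu>"
  using assms
  by (auto simp: pointed_lie_heap_def lie_heap_def lie_semiheap_def smooth_manifold_structure)

lemma pointed_lie_heap_of_lie_group:
  assumes "lie_group M G"
  shows "pointed_lie_heap M (heap_of_group G) \<one>\<^bsub>G\<^esub>"
proof -
  note G = lie_groupD[OF assms]
  interpret group G by (rule G(2))
  note MM = smooth_structure_product[OF G(1) G(1)]
  note MMM = smooth_structure_product[OF G(1) MM]
  note p1 = smooth_map_fst[OF G(1) MM] and p23 = smooth_map_snd[OF G(1) MM]
  note p2 = smooth_map_compose[OF MMM MM p23 smooth_map_fst[OF G(1) G(1)]]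
  note p3 = smooth_map_compose[OF MMM MM p23 smooth_map_snd[OF G(1) G(1)]]
  note i2 = smooth_map_compose[OF MMM G(1) p2 G(5)]
  note q = smooth_map_compose[OF MMM MM smooth_map_pair[OF G(1) G(1) MMM p1 i2] G(4)]
  have "smooth_map (product_manifold M (product_manifold M M)) M
      (\<lambda>t. fst t \<otimes>\<^bsub>G\<^esub> inv\<^bsub>G\<^esub> fst (snd t) \<otimes>\<^bsub>G\<^esub> snd (snd t))"
    using smooth_map_compose[OF MMM MM smooth_map_pair[OF G(1) G(1) MMM q p3] G(4)] by simp
  then have "smooth_map (product_manifold M (product_manifold M M)) M (heap_of_group G)"
    by (rule smooth_map_cong[OF MMM]) (auto simp: heap_of_group_apply G(3))
  then show ?thesis
    using assms heap_heap_of_group[OF G(2)] G(3) one_closed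
    by (auto simp: pointed_lie_heap_def lie_heap_def lie_semiheap_def lie_group_def heap_def)
qed

lemma lie_group_of_pointed_lie_heap:
  assumes "pointed_lie_heap M \<mu> e"
  shows "lie_group M (group_of_heap (points M) \<mu> e)"
proof -
  note H = pointed_lie_heapD[OF assms]
  note MM = smooth_structure_product[OF H(1) H(1)]
  note MMM = smooth_structure_product[OF H(1) MM]
  have triple: "smooth_map P M (\<lambda>x. \<mu> (f x, g x, h x))"
    if "smooth_structure P" "smooth_map P M f" "smooth_map P M g" "smooth_map P M h" for P :: "'b manifold" and f g h
    using smooth_map_compose[OF that(1) MMM smooth_map_pair[OF H(1) MM that(1,2)
          smooth_map_pair[OF H(1) H(1) that(1,3,4)]] H(4)] by simp
  have "smooth_map (product_manifold M M) M (\<lambda>z. \<mu> (fst z, e, snd z))"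
    by (intro triple[OF MM] smooth_map_fst smooth_map_snd smooth_map_const MM H)
  then have "smooth_map (product_manifold M M) M (\<lambda>(x, y). x \<otimes>\<^bsub>group_of_heap (points M) \<mu> e\<^esub> y)"
    by (rule smooth_map_cong[OF MM]) auto
  moreover have "smooth_map M M (\<lambda>x. \<mu> (e, x, e))"
    by (intro triple smooth_map_id smooth_map_const H)
  then have "smooth_map M M (\<lambda>x. inv\<^bsub>group_of_heap (points M) \<mu> e\<^esub> x)"
    by (rule smooth_map_cong[OF H(1)]) (simp add: inv_group_of_heap[OF H(2,3)])
  moreover have "case_prod (mult (group_of_heap (points M) \<mu> e)) \<in> extensional (points M \<times> points M)"
    by (auto simp: group_of_heap_def)
  moreover have "smooth_manifold M"
    using assms by (simp add: pointed_lie_heap_def lie_heap_def lie_semiheap_def)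
  ultimately show ?thesis
    using group_group_of_heap[OF H(2,3)] by (simp add: lie_group_def)
qed

lemma smooth_map_compose_restrict:
  assumes "smooth_structure M" "smooth_structure N" "smooth_map M N f" "smooth_map N P g"
  shows "smooth_map M P (compose (points M) g f)"
  by (rule smooth_map_cong[OF assms(1) smooth_map_compose[OF assms]]) (simp add: compose_def)

lemma smooth_map_id_restrict:
  assumes "smooth_structure M"
  shows "smooth_map M M (\<lambda>x\<in>points M. x)"
  by (rule smooth_map_cong[OF assms smooth_map_id[OF assms]]) simp

lemma compose_restrict_id:
  assumes "f \<in> extensional A" "f \<in> A \<rightarrow> B"
  shows "compose A f (\<lambda>x\<in>A. x) = f" "compose A (\<lambda>x\<in>B. x) f = f"
  using assms by (auto simp: compose_def extensional_def fun_eq_iff)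

lemma group_of_heap_of_lie_group:
  assumes "lie_group M G"
  shows "group_of_heap (points M) (heap_of_group G) \<one>\<^bsub>G\<^esub> = G"
  using group_of_heap_of_group[of G] assms unfolding lie_group_def by metis

lemma lie_group_mult_closed:
  assumes "lie_group M G" "x \<in> points M" "y \<in> points M"
  shows "x \<otimes>\<^bsub>G\<^esub> y \<in> points M"
  using monoid.m_closed[OF group.is_monoid[OF lie_groupD(2)[OF assms(1)]]] lie_groupD(3)[OF assms(1)] assms(2,3)
  by simp

lemma category_LieGrp: "category LieGrp"
  unfolding category_def
proof (intro conjI ballI, goal_cases)
  case (1 X)
  then show ?case
    by (cases X) (auto simp: LieGrp_def hom_def lie_groupD smooth_map_id_restrict lie_group_mult_closed)
next
  case (2 X Y Z f g)
  obtain M G N H P K where eq: "X = (M, G)" "Y = (N, H)" "Z = (P, K)"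
    by (cases X; cases Y; cases Z)
  have G: "lie_group M G" and H: "lie_group N H"
    and f: "f \<in> hom G H" "smooth_map M N f" and g: "g \<in> hom H K" "smooth_map N P g"
    using 2 by (auto simp: LieGrp_def eq)
  have "compose (points M) g f \<in> hom G K"
    using group.hom_compose[OF lie_groupD(2)[OF G] f(1) g(1)] lie_groupD(3)[OF G] by simp
  moreover have "smooth_map M P (compose (points M) g f)"
    by (rule smooth_map_compose_restrict[OF lie_groupD(1)[OF G] lie_groupD(1)[OF H] f(2) g(2)])
  ultimately show ?case
    by (simp add: LieGrp_def eq)
next
  case (3 X Y f)
  then show ?case
    by (cases X; cases Y) (auto simp: LieGrp_def smooth_map_def intro!: compose_restrict_id)
next
  case (4 X Y f)
  then show ?case
    by (cases X; cases Y) (auto simp: LieGrp_def smooth_map_def intro!: compose_restrict_id)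
next
  case (5 W X Y Z f g h)
  then show ?case
    by (cases W; cases X; cases Y; cases Z)
      (auto simp: LieGrp_def smooth_map_def intro!: compose_assoc[symmetric])
qed

lemma category_LieHp_pt: "category LieHp_pt"
  unfolding category_def
proof (intro conjI ballI, goal_cases)
  case (1 X)
  then show ?case
    by (cases X) (auto simp: LieHp_pt_def pointed_lie_heapD smooth_map_id_restrict heap_closed)
next
  case (2 X Y Z f g)
  obtain M \<mu> e N \<nu> e' P \<pi> e'' where eq: "X = (M, \<mu>, e)" "Y = (N, \<nu>, e')" "Z = (P, \<pi>, e'')"
    by (cases X; cases Y; cases Z)
  have X: "pointed_lie_heap M \<mu> e" and Y: "pointed_lie_heap N \<nu> e'"
    and f: "smooth_map M N f" "f e = e'"
      "\<And>x y z. x \<in> points M \<Longrightarrow> y \<in> points M \<Longrightarrow> z \<in> points M \<Longrightarrow> f (\<mu> (x, y, z)) = \<nu> (f x, f y, f z)"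
    and g: "smooth_map N P g" "g e' = e''"
      "\<And>x y z. x \<in> points N \<Longrightarrow> y \<in> points N \<Longrightarrow> z \<in> points N \<Longrightarrow> g (\<nu> (x, y, z)) = \<pi> (g x, g y, g z)"
    using 2 by (auto simp: LieHp_pt_def eq)
  have "smooth_map M P (compose (points M) g f)"
    using smooth_map_compose_restrict[OF _ _ f(1) g(1)] X Y by (simp add: pointed_lie_heapD)
  then show ?case
    using pointed_lie_heapD[OF X] f g
    by (simp add: LieHp_pt_def eq compose_eq heap_closed smooth_map_in_points[OF f(1)])
next
  case (3 X Y f)
  then show ?case
    by (cases X; cases Y) (auto simp: LieHp_pt_def smooth_map_def intro!: compose_restrict_id)
next
  case (4 X Y f)
  then show ?case
    by (cases X; cases Y) (auto simp: LieHp_pt_def smooth_map_def intro!: compose_restrict_id)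
next
  case (5 W X Y Z f g h)
  then show ?case
    by (cases W; cases X; cases Y; cases Z)
      (auto simp: LieHp_pt_def smooth_map_def intro!: compose_assoc[symmetric])
qed

definition lie_group_to_heap :: "('a lie_group_obj, 'a \<Rightarrow> 'a, 'a pointed_lie_heap_obj, 'a \<Rightarrow> 'a) functor_data" where
  "lie_group_to_heap =
     \<lparr> obj_map = (\<lambda>(M, G). (M, heap_of_group G, \<one>\<^bsub>G\<^esub>)), hom_map = (\<lambda>X Y f. f) \<rparr>"

definition lie_heap_to_group :: "('a pointed_lie_heap_obj, 'a \<Rightarrow> 'a, 'a lie_group_obj, 'a \<Rightarrow> 'a) functor_data" where
  "lie_heap_to_group =
     \<lparr> obj_map = (\<lambda>(M, \<mu>, e). (M, group_of_heap (points M) \<mu> e)), hom_map = (\<lambda>X Y f. f) \<rparr>"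

lemma hom_heap_of_group:
  assumes "group G" "group H" "f \<in> hom G H" "x \<in> carrier G" "y \<in> carrier G" "z \<in> carrier G"
  shows "f (heap_of_group G (x, y, z)) = heap_of_group H (f x, f y, f z)"
proof -
  interpret group_hom G H f
    using assms(1-3) by (simp add: group_hom_def group_hom_axioms_def)
  show ?thesis
    using assms(4-6) by (simp add: heap_of_group_apply)
qed

lemma is_functor_lie_group_to_heap: "is_functor LieGrp LieHp_pt lie_group_to_heap"
  unfolding is_functor_def
proof (intro conjI ballI category_LieGrp category_LieHp_pt, goal_cases)
  case (1 X)
  then show ?case
    by (cases X) (auto simp: LieGrp_def LieHp_pt_def lie_group_to_heap_def pointed_lie_heap_of_lie_group)
next
  case (2 X Y f)
  then show ?case
    by (cases X; cases Y)
      (auto simp: LieGrp_def LieHp_pt_def lie_group_to_heap_def lie_groupD hom_heap_of_group hom_one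
        simp flip: lie_groupD(3))
qed (auto simp: LieGrp_def LieHp_pt_def lie_group_to_heap_def)

lemma is_functor_lie_heap_to_group: "is_functor LieHp_pt LieGrp lie_heap_to_group"
  unfolding is_functor_def
proof (intro conjI ballI category_LieGrp category_LieHp_pt, goal_cases)
  case (1 X)
  then show ?case
    by (cases X) (auto simp: LieGrp_def LieHp_pt_def lie_heap_to_group_def lie_group_of_pointed_lie_heap)
next
  case (2 X Y f)
  then show ?case
    by (cases X; cases Y)
      (auto simp: LieGrp_def LieHp_pt_def lie_heap_to_group_def hom_def smooth_map_in_points pointed_lie_heapD)
qed (auto simp: LieGrp_def LieHp_pt_def lie_heap_to_group_def)

theorem theorem2p31:
  shows "\<exists>(F :: ('a lie_group_obj, 'a \<Rightarrow> 'a, 'a pointed_lie_heap_obj, 'a \<Rightarrow> 'a) functor_data)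
          (G :: ('a pointed_lie_heap_obj, 'a \<Rightarrow> 'a, 'a lie_group_obj, 'a \<Rightarrow> 'a) functor_data).
     is_functor LieGrp LieHp_pt F \<and> is_functor LieHp_pt LieGrp G \<and>
     functor_eq LieHp_pt (comp_functor F G) id_functor \<and>
     functor_eq LieGrp (comp_functor G F) id_functor"
proof (intro exI conjI)
  show "functor_eq LieHp_pt (comp_functor lie_group_to_heap lie_heap_to_group) id_functor"
    by (auto simp: functor_eq_def LieHp_pt_def comp_functor_def id_functor_def lie_group_to_heap_def
        lie_heap_to_group_def heap_of_group_of_heap pointed_lie_heapD)
  show "functor_eq LieGrp (comp_functor lie_heap_to_group lie_group_to_heap) id_functor"
    by (auto simp: functor_eq_def LieGrp_def comp_functor_def id_functor_def lie_group_to_heap_def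
        lie_heap_to_group_def group_of_heap_of_lie_group)
qed (rule is_functor_lie_group_to_heap is_functor_lie_heap_to_group)+

end
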